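(* Let $\mathbb{A}$ be a PCA with elementary sub-PCA $\mathbb{A}'$, and let $\mathfrak{T}\colon\mathsf{Set}^{\mathrm{op}}\to\mathsf{Pos}$ be the Turing doctrine. There is an isomorphism of doctrines $$\mathfrak{D}\cong\mathfrak{Dial}_{\mathsf f}(\mathfrak{T}),$$ where $\mathfrak{Dial}_{\mathsf f}(P):=(P^{\forall_{\mathsf f}})^{\exists_{\mathsf f}}$ is the full Dialectica construction on a doctrine $P$.
   Context: A partial combinatory algebra (PCA) is a set $\mathbb{A}$ with a partial binary operation $\cdot$ (application, associating to the left; $ab\downarrow$ means that $ab$ is defined; $x\simeq y$ means that $x$ is defined whenever $y$ is, in which case they are equal) for which there exist $k,s\in\mathbb{A}$ such that for all $a,b,c\in\mathbb{A}$: $ka\downarrow$, $kab\simeq a$, $sa\downarrow$, $sab\downarrow$, $sabc\simeq ac(bc)$. An elementary sub-PCA is a subset $\mathbb{A}'\subseteq\mathbb{A}$ closed under (defined) application that contains elements $k,s$ such that $ka\downarrow$, $kab\simeq a$, $sa\downarrow$, $sab\downarrow$ and $sabc\simeq ac(bc)$ for all $a,b,c\in\mathbb{A}$. Assertions such as $a\cdot b\in S$ include that $a\cdot b$ is defined. A doctrine is a functor $P\colon\mathcal{C}^{\mathrm{op}}\to\mathsf{Pos}$ with $\mathcal{C}$ having finite products; an isomorphism of doctrines on the same base is a natural family of poset isomorphisms. Let $\mathcal{C}$ have pullbacks. Both the full existential completion $P^{\exists_{\mathsf f}}$ and the full universal completion $P^{\forall_{\mathsf f}}$ have as fibre over $A$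 the poset reflection of a preorder on pairs $(f,\alpha)$ with $f\colon B\to A$ in $\mathcal{C}$ and $\alpha\in P(B)$. For $P^{\exists_{\mathsf f}}$: $(f\colon B\to A,\alpha)\le(g\colon C\to A,\beta)$ iff there is $h\colon B\to C$ with $gh=f$ and $\alpha\le P_h(\beta)$. For $P^{\forall_{\mathsf f}}$: $(f\colon B\to A,\alpha)\le(g\colon C\to A,\beta)$ iff there is $h\colon C\to B$ with $fh=g$ and $P_h(\alpha)\le\beta$. In both cases $u\colon A'\to A$ sends $(g\colon C\to A,\beta)$ to $(u^*g\colon D\to A',P_{g^*u}(\beta))$, where $D=A'\times_A C$ with projections $u^*g\colon D\to A'$ and $g^*u\colon D\to C$. Turing doctrine: $\mathfrak{T}(X)$ is (the poset reflection of) the set of functions $X\to\mathbb{A}$ preordered by $\alpha\le_{\mathsf T}\beta$ iff there is $\overline a\in\mathbb{A}'$ such that for every $x\in X$, $\overline a\cdot\beta(x)$ is defined and equals $\alpha(x)$; it acts by precomposition. Doctrine $\mathfrak{D}\colon\mathsf{Set}^{\mathrm{op}}\to\mathsf{Pos}$: $\mathfrak{D}(X)$ is the poset reflection of the preorder whose objects are functions $F\colon R\to\wp(\mathbb{A})$ with $R\subseteq X\times\wp(\mathbb{A})$ (write $x\Vdash_R A$ for $(x,A)\in R$), where for $F\colon R\to\wp(\mathbb{A})$ and $G\colon S\to\wp(\mathbb{A})$, $F\le_D G$ iff there are a function $\varphi\colon R\to\wp(\mathbb{A})$ and $\overline h\in\mathbb{A}'$ such that for every $x\Vdash_R A$: $x\Vdash_S\varphi(x,A)$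 and $(\forall q\in G(x,\varphi(x,A)))(\overline h\cdot q\in F(x,A))$. It acts by precomposition: $u\colon X'\to X$ sends $F\colon R\to\wp(\mathbb{A})$ to $(x',A)\mapsto F(u(x'),A)$ on $\{(x',A):(u(x'),A)\in R\}$. *)

theory Defs
  imports "HOL-Library.FuncSet"
begin

section \<open>Categories\<close>

record ('o, 'm) cat =
  Obj :: "'o set"
  Arr :: "'m set"
  Dom :: "'m \<Rightarrow> 'o"
  Cod :: "'m \<Rightarrow> 'o"
  Ident :: "'o \<Rightarrow> 'm"
  Comp :: "'m \<Rightarrow> 'm \<Rightarrow> 'm"  \<comment> \<open>\<open>Comp C g f\<close> is \<open>g\<close> after \<open>f\<close>\<close>

definition Hom :: "('o, 'm, 'z) cat_scheme \<Rightarrow> 'o \<Rightarrow> 'o \<Rightarrow> 'm set" where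
  "Hom C X Y = {f \<in> Arr C. Dom C f = X \<and> Cod C f = Y}"

locale category =
  fixes C :: "('o, 'm) cat"
  assumes Dom_in_Obj: "f \<in> Arr C \<Longrightarrow> Dom C f \<in> Obj C"
    and Cod_in_Obj: "f \<in> Arr C \<Longrightarrow> Cod C f \<in> Obj C"
    and Ident_in_Hom: "X \<in> Obj C \<Longrightarrow> Ident C X \<in> Hom C X X"
    and Comp_in_Hom: "f \<in> Hom C X Y \<Longrightarrow> g \<in> Hom C Y Z \<Longrightarrow> Comp C g f \<in> Hom C X Z"
    and Comp_Ident: "f \<in> Hom C X Y \<Longrightarrow> Comp C f (Ident C X) = f"
    and Ident_Comp: "f \<in> Hom C X Y \<Longrightarrow> Comp C (Ident C Y) f = f"
    and Comp_assoc: "f \<in> Hom C W X \<Longrightarrow> g \<in> Hom C X Y \<Longrightarrow> h \<in> Hom C Y Z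
      \<Longrightarrow> Comp C h (Comp C g f) = Comp C (Comp C h g) f"

definition terminal :: "('o, 'm) cat \<Rightarrow> 'o \<Rightarrow> bool" where
  "terminal C T \<longleftrightarrow> T \<in> Obj C \<and> (\<forall>X\<in>Obj C. \<exists>!f. f \<in> Hom C X T)"

definition is_product :: "('o, 'm) cat \<Rightarrow> 'o \<Rightarrow> 'o \<Rightarrow> 'o \<Rightarrow> 'm \<Rightarrow> 'm \<Rightarrow> bool" where
  "is_product C X Y Z p q \<longleftrightarrow> Z \<in> Obj C \<and> p \<in> Hom C Z X \<and> q \<in> Hom C Z Y \<and>
     (\<forall>W\<in>Obj C. \<forall>f\<in>Hom C W X. \<forall>g\<in>Hom C W Y.
        \<exists>!h. h \<in> Hom C W Z \<and> Comp C p h = f \<and> Comp C q h = g)"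

definition has_finite_products :: "('o, 'm) cat \<Rightarrow> bool" where
  "has_finite_products C \<longleftrightarrow> (\<exists>T. terminal C T) \<and>
     (\<forall>X\<in>Obj C. \<forall>Y\<in>Obj C. \<exists>Z p q. is_product C X Y Z p q)"

text \<open>
  The square with \<open>p : D \<rightarrow> Dom u\<close>, \<open>q : D \<rightarrow> Dom g\<close> over the cospan \<open>u\<close>, \<open>g\<close> is a
  pullback; thus \<open>p\<close> is \<open>u\<^sup>*g\<close> and \<open>q\<close> is \<open>g\<^sup>*u\<close>.
\<close>
definition is_pullback :: "('o, 'm) cat \<Rightarrow> 'm \<Rightarrow> 'm \<Rightarrow> 'm \<Rightarrow> 'm \<Rightarrow> bool" where
  "is_pullback C u g p q \<longleftrightarrow>
     u \<in> Arr C \<and> g \<in> Arr C \<and> Cod C u = Cod C g \<and>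
     (\<exists>D\<in>Obj C. p \<in> Hom C D (Dom C u) \<and> q \<in> Hom C D (Dom C g) \<and>
        Comp C u p = Comp C g q \<and>
        (\<forall>W\<in>Obj C. \<forall>p'\<in>Hom C W (Dom C u). \<forall>q'\<in>Hom C W (Dom C g).
           Comp C u p' = Comp C g q' \<longrightarrow>
           (\<exists>!h. h \<in> Hom C W D \<and> Comp C p h = p' \<and> Comp C q h = q')))"

section \<open>Doctrines\<close>

record ('o, 'm, 'p) doctrine_data =
  Fib :: "'o \<Rightarrow> 'p set"
  Le :: "'o \<Rightarrow> 'p \<Rightarrow> 'p \<Rightarrow> bool"
  Reindex :: "'m \<Rightarrow> 'p \<Rightarrow> 'p"

locale doctrine = category C for C :: "('o, 'm) cat" +
  fixes P :: "('o, 'm, 'p) doctrine_data"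
  assumes finite_products: "has_finite_products C"
    and Le_refl: "X \<in> Obj C \<Longrightarrow> a \<in> Fib P X \<Longrightarrow> Le P X a a"
    and Le_trans: "X \<in> Obj C \<Longrightarrow> a \<in> Fib P X \<Longrightarrow> b \<in> Fib P X \<Longrightarrow> c \<in> Fib P X
      \<Longrightarrow> Le P X a b \<Longrightarrow> Le P X b c \<Longrightarrow> Le P X a c"
    and Le_antisym: "X \<in> Obj C \<Longrightarrow> a \<in> Fib P X \<Longrightarrow> b \<in> Fib P X
      \<Longrightarrow> Le P X a b \<Longrightarrow> Le P X b a \<Longrightarrow> a = b"
    and Reindex_in_Fib: "u \<in> Hom C Y X \<Longrightarrow> a \<in> Fib P X \<Longrightarrow> Reindex P u a \<in> Fib P Y"
    and Reindex_mono: "u \<in> Hom C Y X \<Longrightarrow> a \<in> Fib P X \<Longrightarrow> b \<in> Fib P X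
      \<Longrightarrow> Le P X a b \<Longrightarrow> Le P Y (Reindex P u a) (Reindex P u b)"
    and Reindex_Ident: "X \<in> Obj C \<Longrightarrow> a \<in> Fib P X \<Longrightarrow> Reindex P (Ident C X) a = a"
    and Reindex_Comp: "v \<in> Hom C Z Y \<Longrightarrow> u \<in> Hom C Y X \<Longrightarrow> a \<in> Fib P X
      \<Longrightarrow> Reindex P (Comp C u v) a = Reindex P v (Reindex P u a)"

definition doctrine_iso ::
    "('o, 'm) cat \<Rightarrow> ('o, 'm, 'p) doctrine_data \<Rightarrow> ('o, 'm, 'q) doctrine_data
      \<Rightarrow> ('o \<Rightarrow> 'p \<Rightarrow> 'q) \<Rightarrow> bool" where
  "doctrine_iso C P Q \<Phi> \<longleftrightarrow> doctrine C P \<and> doctrine C Q \<and>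
     (\<forall>X\<in>Obj C. bij_betw (\<Phi> X) (Fib P X) (Fib Q X) \<and>
        (\<forall>a\<in>Fib P X. \<forall>b\<in>Fib P X. Le P X a b \<longleftrightarrow> Le Q X (\<Phi> X a) (\<Phi> X b))) \<and>
     (\<forall>u\<in>Arr C. \<forall>a\<in>Fib P (Cod C u).
        \<Phi> (Dom C u) (Reindex P u a) = Reindex Q u (\<Phi> (Cod C u) a))"

definition doctrines_isomorphic ::
    "('o, 'm) cat \<Rightarrow> ('o, 'm, 'p) doctrine_data \<Rightarrow> ('o, 'm, 'q) doctrine_data \<Rightarrow> bool" where
  "doctrines_isomorphic C P Q \<longleftrightarrow> (\<exists>\<Phi>. doctrine_iso C P Q \<Phi>)"

text \<open>
  Fibrewise poset reflection of preorders \<open>le X\<close> on \<open>S X\<close>. Elements of the reflected fibres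
  are equivalence classes. The action \<open>act u x\<close> is the set of all admissible results of
  reindexing \<open>x\<close> along \<open>u\<close>; this allows actions that are determined only up to equivalence,
  such as those given by pullbacks, without choosing a representative.
\<close>
definition eq_class :: "'x set \<Rightarrow> ('x \<Rightarrow> 'x \<Rightarrow> bool) \<Rightarrow> 'x \<Rightarrow> 'x set" where
  "eq_class S le x = {y \<in> S. le x y \<and> le y x}"

definition poset_reflection ::
    "('o, 'm) cat \<Rightarrow> ('o \<Rightarrow> 'x set) \<Rightarrow> ('o \<Rightarrow> 'x \<Rightarrow> 'x \<Rightarrow> bool) \<Rightarrow> ('m \<Rightarrow> 'x \<Rightarrow> 'x set)
      \<Rightarrow> ('o, 'm, 'x set) doctrine_data" where
  "poset_reflection C S le act =
     \<lparr>Fib = (\<lambda>X. eq_class (S X) (le X) ` S X),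
      Le = (\<lambda>X E F. \<exists>x\<in>E. \<exists>y\<in>F. le X x y),
      Reindex = (\<lambda>u E. \<Union>x\<in>E. \<Union>y\<in>act u x. eq_class (S (Dom C u)) (le (Dom C u)) y)\<rparr>"

section \<open>Full existential and universal completions\<close>

definition completion_pairs ::
    "('o, 'm) cat \<Rightarrow> ('o, 'm, 'p) doctrine_data \<Rightarrow> 'o \<Rightarrow> ('m \<times> 'p) set" where
  "completion_pairs C P A = {(f, \<alpha>). f \<in> Arr C \<and> Cod C f = A \<and> \<alpha> \<in> Fib P (Dom C f)}"

definition completion_act ::
    "('o, 'm) cat \<Rightarrow> ('o, 'm, 'p) doctrine_data \<Rightarrow> 'm \<Rightarrow> 'm \<times> 'p \<Rightarrow> ('m \<times> 'p) set" where
  "completion_act C P u = (\<lambda>(g, \<beta>). {(p, Reindex P q \<beta>) | p q. is_pullback C u g p q})"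

definition ex_le ::
    "('o, 'm) cat \<Rightarrow> ('o, 'm, 'p) doctrine_data \<Rightarrow> 'm \<times> 'p \<Rightarrow> 'm \<times> 'p \<Rightarrow> bool" where
  "ex_le C P = (\<lambda>(f, \<alpha>) (g, \<beta>). \<exists>h\<in>Hom C (Dom C f) (Dom C g).
     Comp C g h = f \<and> Le P (Dom C f) \<alpha> (Reindex P h \<beta>))"

definition univ_le ::
    "('o, 'm) cat \<Rightarrow> ('o, 'm, 'p) doctrine_data \<Rightarrow> 'm \<times> 'p \<Rightarrow> 'm \<times> 'p \<Rightarrow> bool" where
  "univ_le C P = (\<lambda>(f, \<alpha>) (g, \<beta>). \<exists>h\<in>Hom C (Dom C g) (Dom C f).
     Comp C f h = g \<and> Le P (Dom C g) (Reindex P h \<alpha>) \<beta>)"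

definition full_ex_completion ::
    "('o, 'm) cat \<Rightarrow> ('o, 'm, 'p) doctrine_data \<Rightarrow> ('o, 'm, ('m \<times> 'p) set) doctrine_data" where
  "full_ex_completion C P =
     poset_reflection C (completion_pairs C P) (\<lambda>_. ex_le C P) (completion_act C P)"

definition full_univ_completion ::
    "('o, 'm) cat \<Rightarrow> ('o, 'm, 'p) doctrine_data \<Rightarrow> ('o, 'm, ('m \<times> 'p) set) doctrine_data" where
  "full_univ_completion C P =
     poset_reflection C (completion_pairs C P) (\<lambda>_. univ_le C P) (completion_act C P)"

definition full_dialectica ::
    "('o, 'm) cat \<Rightarrow> ('o, 'm, 'p) doctrine_data
      \<Rightarrow> ('o, 'm, ('m \<times> ('m \<times> 'p) set) set) doctrine_data" where
  "full_dialectica C P = full_ex_completion C (full_univ_completion C P)"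

section \<open>Partial combinatory algebras\<close>

definition papp :: "('a \<Rightarrow> 'a \<Rightarrow> 'a option) \<Rightarrow> 'a option \<Rightarrow> 'a option \<Rightarrow> 'a option" where
  "papp app x y = Option.bind x (\<lambda>a. Option.bind y (app a))"

text \<open>The directed equality \<open>x \<simeq> y\<close>: if \<open>y\<close> is defined, then so is \<open>x\<close>, and they are equal.\<close>
definition dir_eq :: "'a option \<Rightarrow> 'a option \<Rightarrow> bool" where
  "dir_eq x y \<longleftrightarrow> (y \<noteq> None \<longrightarrow> x = y)"

definition is_ks :: "'a set \<Rightarrow> ('a \<Rightarrow> 'a \<Rightarrow> 'a option) \<Rightarrow> 'a \<Rightarrow> 'a \<Rightarrow> bool" where
  "is_ks \<AA> app k s \<longleftrightarrow> (\<forall>a\<in>\<AA>. \<forall>b\<in>\<AA>. \<forall>c\<in>\<AA>.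
     app k a \<noteq> None \<and>
     dir_eq (papp app (app k a) (Some b)) (Some a) \<and>
     app s a \<noteq> None \<and>
     papp app (app s a) (Some b) \<noteq> None \<and>
     dir_eq (papp app (papp app (app s a) (Some b)) (Some c)) (papp app (app a c) (app b c)))"

locale pca =
  fixes \<AA> :: "'a set" and app :: "'a \<Rightarrow> 'a \<Rightarrow> 'a option"
  assumes app_closed: "a \<in> \<AA> \<Longrightarrow> b \<in> \<AA> \<Longrightarrow> app a b = Some c \<Longrightarrow> c \<in> \<AA>"
    and ex_ks: "\<exists>k\<in>\<AA>. \<exists>s\<in>\<AA>. is_ks \<AA> app k s"

locale elementary_sub_pca = pca \<AA> app
  for \<AA> :: "'a set" and app :: "'a \<Rightarrow> 'a \<Rightarrow> 'a option" +
  fixes \<AA>' :: "'a set"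
  assumes sub_subset: "\<AA>' \<subseteq> \<AA>"
    and sub_app_closed: "a \<in> \<AA>' \<Longrightarrow> b \<in> \<AA>' \<Longrightarrow> app a b = Some c \<Longrightarrow> c \<in> \<AA>'"
    and sub_ex_ks: "\<exists>k\<in>\<AA>'. \<exists>s\<in>\<AA>'. is_ks \<AA> app k s"

section \<open>The category of sets\<close>

text \<open>
  There is no HOL type whose elements are all sets, so the category of sets is taken relative
  to a universe \<open>U\<close>: its objects are the members of \<open>U\<close> and its arrows are all functions
  between them. Being a set of \<^emph>\<open>subsets\<close> of an arbitrary type \<open>'u\<close>, \<open>U\<close> may be the collection
  of all small subsets of a type of ZF sets or of the elements of a Grothendieck universe
  (closed under far more than is required here), or simply all subsets of a sufficiently
  large type. Closure under products and power sets is meant up to bijection, as \<open>'u\<close> need not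
  contain set-theoretic pairs or sets. The algebra itself may live in another type; that its
  power set is a set of the universe is the second clause of \<open>set_universe_for\<close>.
\<close>
definition small_in :: "'u set set \<Rightarrow> 'b set \<Rightarrow> bool" where
  "small_in U B \<longleftrightarrow> (\<exists>X\<in>U. \<exists>e. bij_betw e X B)"

locale set_universe_for =
  fixes U :: "'u set set" and \<AA> :: "'a set"
  assumes subset_closed: "X \<in> U \<Longrightarrow> Y \<subseteq> X \<Longrightarrow> Y \<in> U"
    and Pow_small: "small_in U (Pow \<AA>)"
    and Times_small: "X \<in> U \<Longrightarrow> Y \<in> U \<Longrightarrow> small_in U (X \<times> Y)"

text \<open>All subsets of any sufficiently large infinite type form such a universe.\<close>
lemma set_universe_for_UNIV:
  fixes \<AA> :: "'a set" and e :: "'a set \<Rightarrow> 'u"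
  assumes "infinite (UNIV :: 'u set)" and "inj_on e (Pow \<AA>)"
  shows "set_universe_for (UNIV :: 'u set set) \<AA>"
proof
  show "small_in (UNIV :: 'u set set) (Pow \<AA>)"
    unfolding small_in_def
    using bij_betw_inv_into[OF inj_on_imp_bij_betw[OF assms(2)]] by blast
  have "(card_of ((UNIV :: 'u set) \<times> (UNIV :: 'u set)), card_of (UNIV :: 'u set)) \<in> ordIso"
    by (rule card_of_Times_same_infinite[OF assms(1)])
  then obtain t :: "'u \<times> 'u \<Rightarrow> 'u" where "inj t"
    using card_of_ordIso[of "(UNIV :: 'u set) \<times> (UNIV :: 'u set)" "UNIV :: 'u set"]
    by (auto simp: bij_betw_def)
  then show "small_in (UNIV :: 'u set set) (X \<times> Y)" for X Y :: "'u set"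
    unfolding small_in_def
    using bij_betw_inv_into[OF inj_on_imp_bij_betw[of t "X \<times> Y"]] inj_on_subset by blast
qed auto

text \<open>Arrows are triples (domain, codomain, graph function), extensional on the domain.\<close>
type_synonym 'u fn = "'u set \<times> 'u set \<times> ('u \<Rightarrow> 'u)"

definition Set_cat :: "'u set set \<Rightarrow> ('u set, 'u fn) cat" where
  "Set_cat U =
     \<lparr>Obj = U,
      Arr = {(X, Y, f). X \<in> U \<and> Y \<in> U \<and> f \<in> X \<rightarrow>\<^sub>E Y},
      Dom = (\<lambda>(X, Y, f). X),
      Cod = (\<lambda>(X, Y, f). Y),
      Ident = (\<lambda>X. (X, X, \<lambda>x\<in>X. x)),
      Comp = (\<lambda>(Y', Z, g) (X, Y, f). (X, Z, compose X g f))\<rparr>"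

section \<open>The Turing doctrine\<close>

definition turing_le ::
    "('a \<Rightarrow> 'a \<Rightarrow> 'a option) \<Rightarrow> 'a set \<Rightarrow> 'u set \<Rightarrow> ('u \<Rightarrow> 'a) \<Rightarrow> ('u \<Rightarrow> 'a) \<Rightarrow> bool" where
  "turing_le app \<AA>' X \<alpha> \<beta> \<longleftrightarrow> (\<exists>a\<in>\<AA>'. \<forall>x\<in>X. app a (\<beta> x) = Some (\<alpha> x))"

definition turing_doctrine ::
    "'u set set \<Rightarrow> 'a set \<Rightarrow> ('a \<Rightarrow> 'a \<Rightarrow> 'a option) \<Rightarrow> 'a set
      \<Rightarrow> ('u set, 'u fn, ('u \<Rightarrow> 'a) set) doctrine_data" where
  "turing_doctrine U \<AA> app \<AA>' =
     poset_reflection (Set_cat U) (\<lambda>X. X \<rightarrow>\<^sub>E \<AA>) (turing_le app \<AA>')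
       (\<lambda>(X', X, u) \<alpha>. {compose X' \<alpha> u})"

section \<open>The doctrine \<open>\<DD>\<close>\<close>

text \<open>A function \<open>F : R \<rightarrow> \<wp>(\<AA>)\<close> with \<open>R \<subseteq> X \<times> \<wp>(\<AA>)\<close> is represented by the pair \<open>(R, F)\<close>.\<close>
type_synonym ('u, 'a) dobj = "('u \<times> 'a set) set \<times> ('u \<times> 'a set \<Rightarrow> 'a set)"

definition D_objs :: "'a set \<Rightarrow> 'u set \<Rightarrow> ('u, 'a) dobj set" where
  "D_objs \<AA> X = {(R, F). R \<subseteq> X \<times> Pow \<AA> \<and> F \<in> R \<rightarrow>\<^sub>E Pow \<AA>}"

definition D_le ::
    "'a set \<Rightarrow> ('a \<Rightarrow> 'a \<Rightarrow> 'a option) \<Rightarrow> 'a set \<Rightarrow> ('u, 'a) dobj \<Rightarrow> ('u, 'a) dobj \<Rightarrow> bool" where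
  "D_le \<AA> app \<AA>' = (\<lambda>(R, F) (S, G). \<exists>\<phi>\<in>R \<rightarrow> Pow \<AA>. \<exists>h\<in>\<AA>'. \<forall>(x, A)\<in>R.
     (x, \<phi> (x, A)) \<in> S \<and>
     (\<forall>q\<in>G (x, \<phi> (x, A)). \<exists>r\<in>F (x, A). app h q = Some r))"

definition D_act :: "'u fn \<Rightarrow> ('u, 'a) dobj \<Rightarrow> ('u, 'a) dobj" where
  "D_act = (\<lambda>(X', X, u) (R, F).
     let R' = {(x', A). x' \<in> X' \<and> (u x', A) \<in> R} in (R', \<lambda>(x', A)\<in>R'. F (u x', A)))"

definition D_doctrine ::
    "'u set set \<Rightarrow> 'a set \<Rightarrow> ('a \<Rightarrow> 'a \<Rightarrow> 'a option) \<Rightarrow> 'a set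
      \<Rightarrow> ('u set, 'u fn, ('u, 'a) dobj set) doctrine_data" where
  "D_doctrine U \<AA> app \<AA>' =
     poset_reflection (Set_cat U) (D_objs \<AA>) (\<lambda>_. D_le \<AA> app \<AA>') (\<lambda>u F. {D_act u F})"

end

theory Submission
  imports Defs
begin

text \<open>
  An element of the Dialectica fibre over \<open>X\<close> is a function \<open>f : B \<rightarrow> X\<close> together with
  \<open>g : C \<rightarrow> B\<close> and \<open>\<alpha> : C \<rightarrow> \<AA>\<close>. By the axiom of choice, the order of the universal completion sees
  of \<open>(g, \<alpha>)\<close> only the family of sets \<open>Q b = \<alpha> ` g\<^sup>-\<^sup>1(b)\<close>, and every family \<open>Q : B \<rightarrow> \<wp>(\<AA>)\<close> arises in
  this way. By choice again, the order of the existential completion sees of \<open>(f, Q)\<close> only the set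
  \<open>R = {(f b, Q b) | b \<in> B}\<close>. This is the element \<open>F(x, A) = A\<close> of \<open>\<DD>(X)\<close> on \<open>R\<close>, and every element
  \<open>F : S \<rightarrow> \<wp>(\<AA>)\<close> of \<open>\<DD>(X)\<close> is equivalent to the one obtained from \<open>B = S\<close>, the projection to \<open>X\<close>
  and \<open>Q = F\<close>.
\<close>

section \<open>Poset reflections of preorders with reindexing given up to equivalence\<close>

section \<open>Doctrines presented by preorders\<close>

text \<open>The action is set-valued because a pullback is determined only up to isomorphism. Taking
  \<open>x' = x\<close> in \<open>act_mono\<close> makes any two results of one reindexing
  equivalent, so for identities and composites membership among the admissible results
  suffices.\<close>

locale preordered_action = category C for C :: "('o, 'm) cat" +
  fixes S :: "'o \<Rightarrow> 'x set" and le :: "'o \<Rightarrow> 'x \<Rightarrow> 'x \<Rightarrow> bool"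
    and act :: "'m \<Rightarrow> 'x \<Rightarrow> 'x set"
  assumes le_refl: "X \<in> Obj C \<Longrightarrow> x \<in> S X \<Longrightarrow> le X x x"
    and le_trans: "X \<in> Obj C \<Longrightarrow> x \<in> S X \<Longrightarrow> y \<in> S X \<Longrightarrow> z \<in> S X
      \<Longrightarrow> le X x y \<Longrightarrow> le X y z \<Longrightarrow> le X x z"
    and act_closed: "u \<in> Hom C Y X \<Longrightarrow> x \<in> S X \<Longrightarrow> y \<in> act u x \<Longrightarrow> y \<in> S Y"
    and act_nonempty: "u \<in> Hom C Y X \<Longrightarrow> x \<in> S X \<Longrightarrow> \<exists>y. y \<in> act u x"
    and act_mono: "u \<in> Hom C Y X \<Longrightarrow> x \<in> S X \<Longrightarrow> x' \<in> S X \<Longrightarrow> le X x x'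
      \<Longrightarrow> y \<in> act u x \<Longrightarrow> y' \<in> act u x' \<Longrightarrow> le Y y y'"
    and act_Ident: "X \<in> Obj C \<Longrightarrow> x \<in> S X \<Longrightarrow> x \<in> act (Ident C X) x"
    and act_Comp: "v \<in> Hom C Z Y \<Longrightarrow> u \<in> Hom C Y X \<Longrightarrow> x \<in> S X
      \<Longrightarrow> y \<in> act u x \<Longrightarrow> z \<in> act v y \<Longrightarrow> z \<in> act (Comp C u v) x"
begin

abbreviation cls :: "'o \<Rightarrow> 'x \<Rightarrow> 'x set" where
  "cls X \<equiv> eq_class (S X) (le X)"

abbreviation reflection :: "('o, 'm, 'x set) doctrine_data" where
  "reflection \<equiv> poset_reflection C S le act"

lemma Fib_reflection: "Fib reflection X = cls X ` S X"
  by (simp add: poset_reflection_def)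

lemma cls_self: "X \<in> Obj C \<Longrightarrow> x \<in> S X \<Longrightarrow> x \<in> cls X x"
  by (simp add: eq_class_def le_refl)

lemma cls_eq_iff:
  assumes "X \<in> Obj C" "x \<in> S X" "y \<in> S X"
  shows "cls X x = cls X y \<longleftrightarrow> le X x y \<and> le X y x"
proof
  assume "cls X x = cls X y"
  then have "y \<in> cls X x"
    using cls_self[OF assms(1,3)] by simp
  then show "le X x y \<and> le X y x"
    by (simp add: eq_class_def)
next
  assume "le X x y \<and> le X y x"
  then show "cls X x = cls X y"
    using assms le_trans unfolding eq_class_def by blast
qed

lemma Le_reflection:
  assumes "X \<in> Obj C" "x \<in> S X" "y \<in> S X"
  shows "Le reflection X (cls X x) (cls X y) \<longleftrightarrow> le X x y"
proof
  assume "Le reflection X (cls X x) (cls X y)"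
  then obtain x' y' where "x' \<in> S X" "le X x x'" "y' \<in> S X" "le X y' y" "le X x' y'"
    by (auto simp: poset_reflection_def eq_class_def)
  then show "le X x y"
    using assms le_trans by blast
next
  assume "le X x y"
  then show "Le reflection X (cls X x) (cls X y)"
    using assms cls_self by (auto simp: poset_reflection_def)
qed

text \<open>Applying \<open>act_mono\<close> in both directions shows that every admissible result,
  for every representative of the class, is equivalent to \<open>y\<close>. The union defining
  \<open>Reindex\<close> thus collapses to one class, and any single result may be used to compute
  it.\<close>

lemma Reindex_reflection:
  assumes u: "u \<in> Hom C Y X" and x: "x \<in> S X" and y: "y \<in> act u x"
  shows "Reindex reflection u (cls X x) = cls Y y"
proof -
  have X: "X \<in> Obj C" and Y: "Y \<in> Obj C" and Du: "Dom C u = Y"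
    using u Dom_in_Obj Cod_in_Obj by (auto simp: Hom_def)
  have "cls Y y' = cls Y y" if "x' \<in> cls X x" "y' \<in> act u x'" for x' y'
  proof -
    have x': "x' \<in> S X" "le X x x'" "le X x' x"
      using that(1) by (auto simp: eq_class_def)
    show ?thesis
      using act_closed[OF u x y] act_closed[OF u x'(1) that(2)]
        act_mono[OF u x x'(1,2) y that(2)] act_mono[OF u x'(1) x x'(3) that(2) y]
      by (subst cls_eq_iff[OF Y]) auto
  qed
  then have "(\<Union>x'\<in>cls X x. \<Union>y'\<in>act u x'. cls Y y') = cls Y y"
    using cls_self[OF X x] y by blast
  then show ?thesis
    by (simp add: poset_reflection_def Du)
qed

lemma doctrine_reflection:
  assumes "has_finite_products C"
  shows "doctrine C reflection"
proof
  show "has_finite_products C" by fact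
next
  fix X a assume "X \<in> Obj C" "a \<in> Fib reflection X"
  then show "Le reflection X a a"
    by (auto simp: Fib_reflection Le_reflection le_refl)
next
  fix X a b c assume "X \<in> Obj C" "a \<in> Fib reflection X" "b \<in> Fib reflection X" "c \<in> Fib reflection X"
    "Le reflection X a b" "Le reflection X b c"
  then show "Le reflection X a c"
    unfolding Fib_reflection by (elim imageE) (simp add: Le_reflection, rule le_trans)
next
  fix X a b assume "X \<in> Obj C" "a \<in> Fib reflection X" "b \<in> Fib reflection X"
    "Le reflection X a b" "Le reflection X b a"
  then show "a = b"
    unfolding Fib_reflection by (elim imageE) (simp add: Le_reflection cls_eq_iff)
next
  fix u X Y a assume u: "u \<in> Hom C Y X" "a \<in> Fib reflection X"
  then obtain x y where "x \<in> S X" "a = cls X x" "y \<in> act u x"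
    using act_nonempty unfolding Fib_reflection by blast
  then show "Reindex reflection u a \<in> Fib reflection Y"
    using u act_closed by (auto simp: Fib_reflection Reindex_reflection)
next
  fix u X Y a b assume u: "u \<in> Hom C Y X" and ab: "a \<in> Fib reflection X" "b \<in> Fib reflection X"
    "Le reflection X a b"
  have X: "X \<in> Obj C" "Y \<in> Obj C"
    using u Dom_in_Obj Cod_in_Obj by (auto simp: Hom_def)
  obtain x y x' y' where x: "x \<in> S X" "a = cls X x" "y \<in> act u x"
    "x' \<in> S X" "b = cls X x'" "y' \<in> act u x'"
    using ab u act_nonempty unfolding Fib_reflection by blast
  then show "Le reflection Y (Reindex reflection u a) (Reindex reflection u b)"
    using u ab X act_closed[OF u] act_mono[OF u x(1,4) _ x(3,6)]
    by (simp add: Reindex_reflection[OF u x(1,3)] Reindex_reflection[OF u x(4,6)] Le_reflection)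
next
  fix X a assume "X \<in> Obj C" "a \<in> Fib reflection X"
  then show "Reindex reflection (Ident C X) a = a"
    using Reindex_reflection[OF Ident_in_Hom _ act_Ident] unfolding Fib_reflection by blast
next
  fix u v X Y Z a assume v: "v \<in> Hom C Z Y" and u: "u \<in> Hom C Y X" and a: "a \<in> Fib reflection X"
  obtain x y where x: "x \<in> S X" "a = cls X x" "y \<in> act u x"
    using a u act_nonempty unfolding Fib_reflection by blast
  moreover obtain z where "z \<in> act v y"
    using act_nonempty[OF v act_closed[OF u x(1,3)]] by blast
  ultimately show "Reindex reflection (Comp C u v) a = Reindex reflection v (Reindex reflection u a)"
    using Reindex_reflection[OF u x(1,3)] Reindex_reflection[OF v act_closed[OF u x(1,3)]]
      Reindex_reflection[OF Comp_in_Hom[OF v u] x(1) act_Comp[OF v u x(1,3)]]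
    by auto
qed

text \<open>The axioms are symmetric under reversal of the order: only the roles of \<open>x\<close>
  and \<open>x'\<close> in \<open>act_mono\<close> are exchanged. This lets the universal completion
  be treated as an order dual.\<close>

lemma dual: "preordered_action C S (\<lambda>X x y. le X y x) act"
  by unfold_locales
    (blast intro: le_refl le_trans act_closed act_nonempty act_mono act_Ident act_Comp)+

end

text \<open>A relation replaces a map because representatives on the two sides correspond only after
  choices. By \<open>le_iff\<close> related elements have the same equivalences, so
  \<open>rel\<close> induces a well-defined, injective map on classes; totality on both sides makes
  it a bijection. For naturality one related pair of results is enough, since any result represents
  the reindexed class.\<close>

lemma doctrines_isomorphic_reflectionI:
  fixes C :: "('o, 'm) cat" and rel :: "'o \<Rightarrow> 'x \<Rightarrow> 'y \<Rightarrow> bool"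
  assumes S: "preordered_action C S le act" and S': "preordered_action C S' le' act'"
    and products: "has_finite_products C"
    and left_total: "\<And>X x. X \<in> Obj C \<Longrightarrow> x \<in> S X \<Longrightarrow> \<exists>y\<in>S' X. rel X x y"
    and right_total: "\<And>X y. X \<in> Obj C \<Longrightarrow> y \<in> S' X \<Longrightarrow> \<exists>x\<in>S X. rel X x y"
    and le_iff: "\<And>X x x' y y'. X \<in> Obj C \<Longrightarrow> x \<in> S X \<Longrightarrow> x' \<in> S X \<Longrightarrow> y \<in> S' X \<Longrightarrow> y' \<in> S' X
      \<Longrightarrow> rel X x y \<Longrightarrow> rel X x' y' \<Longrightarrow> le X x x' \<longleftrightarrow> le' X y y'"
    and act_rel: "\<And>u X Y x y. u \<in> Hom C Y X \<Longrightarrow> x \<in> S X \<Longrightarrow> y \<in> S' X \<Longrightarrow> rel X x y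
      \<Longrightarrow> \<exists>x'\<in>act u x. \<exists>y'\<in>act' u y. rel Y x' y'"
  shows "doctrines_isomorphic C (poset_reflection C S le act) (poset_reflection C S' le' act')"
proof -
  interpret S: preordered_action C S le act by fact
  interpret S': preordered_action C S' le' act' by fact
  \<comment> \<open>All classes collected here coincide when \<open>E\<close> is a class, so the
    union is that common class and no representative has to be selected.\<close>
  define \<Phi> where "\<Phi> X E = \<Union>{S'.cls X y | x y. x \<in> E \<and> y \<in> S' X \<and> rel X x y}" for X E
  have \<Phi>: "\<Phi> X (S.cls X x) = S'.cls X y"
    if "X \<in> Obj C" "x \<in> S X" "y \<in> S' X" "rel X x y" for X x y
  proof -
    have "S'.cls X y2 = S'.cls X y" if "x2 \<in> S.cls X x" "y2 \<in> S' X" "rel X x2 y2" for x2 y2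
    proof -
      have "x2 \<in> S X" "le X x x2" "le X x2 x"
        using \<open>x2 \<in> S.cls X x\<close> by (auto simp: eq_class_def)
      then show ?thesis
        using le_iff \<open>X \<in> Obj C\<close> \<open>x \<in> S X\<close> \<open>y \<in> S' X\<close> \<open>rel X x y\<close> that
        by (subst S'.cls_eq_iff) blast+
    qed
    then show ?thesis
      using S.cls_self[OF that(1,2)] that(3,4) unfolding \<Phi>_def by blast
  qed
  have represent: "\<exists>x y. a = S.cls X x \<and> x \<in> S X \<and> y \<in> S' X \<and> rel X x y"
    if "X \<in> Obj C" "a \<in> Fib S.reflection X" for X a
    using left_total that unfolding S.Fib_reflection by blast
  have "doctrine_iso C S.reflection S'.reflection \<Phi>"
    unfolding doctrine_iso_def
  proof (intro conjI ballI)
    show "doctrine C S.reflection" "doctrine C S'.reflection"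
      using S.doctrine_reflection S'.doctrine_reflection products by auto
  next
    fix X assume X: "X \<in> Obj C"
    show "bij_betw (\<Phi> X) (Fib S.reflection X) (Fib S'.reflection X)"
      unfolding bij_betw_def
    proof
      show "inj_on (\<Phi> X) (Fib S.reflection X)"
      proof (rule inj_onI)
        fix a b assume a: "a \<in> Fib S.reflection X" and b: "b \<in> Fib S.reflection X"
          and eq: "\<Phi> X a = \<Phi> X b"
        obtain x y where x: "a = S.cls X x" "x \<in> S X" "y \<in> S' X" "rel X x y"
          using represent[OF X a] by blast
        obtain x' y' where x': "b = S.cls X x'" "x' \<in> S X" "y' \<in> S' X" "rel X x' y'"
          using represent[OF X b] by blast
        have "le' X y y' \<and> le' X y' y"
          using eq \<Phi>[OF X x(2-4)] \<Phi>[OF X x'(2-4)] S'.cls_eq_iff[OF X x(3) x'(3)] x(1) x'(1) by simp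
        then show "a = b"
          using le_iff[OF X] x x' by (simp add: S.cls_eq_iff[OF X])
      qed
      show "\<Phi> X ` Fib S.reflection X = Fib S'.reflection X"
      proof
        show "\<Phi> X ` Fib S.reflection X \<subseteq> Fib S'.reflection X"
          using left_total[OF X] \<Phi>[OF X] by (fastforce simp: S.Fib_reflection S'.Fib_reflection)
        show "Fib S'.reflection X \<subseteq> \<Phi> X ` Fib S.reflection X"
        proof
          fix b assume "b \<in> Fib S'.reflection X"
          then obtain x y where "b = S'.cls X y" "y \<in> S' X" "x \<in> S X" "rel X x y"
            using right_total[OF X] unfolding S'.Fib_reflection by blast
          then show "b \<in> \<Phi> X ` Fib S.reflection X"
            using \<Phi>[OF X, of x y] by (auto simp: S.Fib_reflection)
        qed
      qed
    qed
    fix a b assume a: "a \<in> Fib S.reflection X" and b: "b \<in> Fib S.reflection X"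
    obtain x y where x: "a = S.cls X x" "x \<in> S X" "y \<in> S' X" "rel X x y"
      using represent[OF X a] by blast
    obtain x' y' where x': "b = S.cls X x'" "x' \<in> S X" "y' \<in> S' X" "rel X x' y'"
      using represent[OF X b] by blast
    show "Le S.reflection X a b \<longleftrightarrow> Le S'.reflection X (\<Phi> X a) (\<Phi> X b)"
      using le_iff[OF X x(2) x'(2) x(3) x'(3) x(4) x'(4)] x x'
      by (simp add: \<Phi>[OF X] S.Le_reflection[OF X] S'.Le_reflection[OF X])
  next
    fix u a assume u: "u \<in> Arr C" and a: "a \<in> Fib S.reflection (Cod C u)"
    let ?X = "Cod C u" and ?Y = "Dom C u"
    have hom: "u \<in> Hom C ?Y ?X" and X: "?X \<in> Obj C" and Y: "?Y \<in> Obj C"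
      using u S.Dom_in_Obj S.Cod_in_Obj by (auto simp: Hom_def)
    obtain x y where x: "a = S.cls ?X x" "x \<in> S ?X" "y \<in> S' ?X" "rel ?X x y"
      using represent[OF X a] by blast
    obtain x' y' where x': "x' \<in> act u x" "y' \<in> act' u y" "rel ?Y x' y'"
      using act_rel[OF hom x(2-4)] by blast
    show "\<Phi> ?Y (Reindex S.reflection u a) = Reindex S'.reflection u (\<Phi> ?X a)"
      using S.Reindex_reflection[OF hom x(2) x'(1)] S'.Reindex_reflection[OF hom x(3) x'(2)]
        \<Phi>[OF X x(2-4)] \<Phi>[OF Y S.act_closed[OF hom x(2) x'(1)] S'.act_closed[OF hom x(3) x'(2)] x'(3)]
        x(1)
      by simp
  qed
  then show ?thesis
    unfolding doctrines_isomorphic_def by blast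
qed

section \<open>Pullback calculus and the two completions over a base with pullbacks\<close>

section \<open>Completions\<close>

context category
begin

lemma Hom_Obj: "f \<in> Hom C X Y \<Longrightarrow> X \<in> Obj C" "f \<in> Hom C X Y \<Longrightarrow> Y \<in> Obj C"
  using Dom_in_Obj Cod_in_Obj by (auto simp: Hom_def)

lemma is_pullbackI:
  assumes "u \<in> Hom C Y X" "g \<in> Hom C Z X" "p \<in> Hom C D Y" "q \<in> Hom C D Z"
    and "Comp C u p = Comp C g q"
    and "\<And>W p' q'. W \<in> Obj C \<Longrightarrow> p' \<in> Hom C W Y \<Longrightarrow> q' \<in> Hom C W Z
      \<Longrightarrow> Comp C u p' = Comp C g q'
      \<Longrightarrow> \<exists>!h. h \<in> Hom C W D \<and> Comp C p h = p' \<and> Comp C q h = q'"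
  shows "is_pullback C u g p q"
proof -
  have "u \<in> Arr C" "g \<in> Arr C" "Cod C u = X" "Cod C g = X" "Dom C u = Y" "Dom C g = Z" "D \<in> Obj C"
    using assms(1-3) Hom_Obj by (auto simp: Hom_def)
  then show ?thesis
    unfolding is_pullback_def by (intro conjI bexI[of _ D] ballI impI) (simp_all add: assms(3-6))
qed

lemma is_pullbackD:
  assumes "is_pullback C u g p q" and "u \<in> Hom C Y X"
  shows "g \<in> Hom C (Dom C g) X" "p \<in> Hom C (Dom C p) Y" "q \<in> Hom C (Dom C p) (Dom C g)"
    "Comp C u p = Comp C g q"
  using assms unfolding is_pullback_def Hom_def by auto

lemma is_pullback_lift:
  assumes "is_pullback C u g p q" and "u \<in> Hom C Y X"
    and "p' \<in> Hom C W Y" "q' \<in> Hom C W (Dom C g)" "Comp C u p' = Comp C g q'"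
  shows "\<exists>!h. h \<in> Hom C W (Dom C p) \<and> Comp C p h = p' \<and> Comp C q h = q'"
  using assms Hom_Obj(1)[OF assms(3)] unfolding is_pullback_def Hom_def by auto

lemma pullback_Ident:
  assumes g: "g \<in> Hom C Y X"
  shows "is_pullback C (Ident C X) g g (Ident C Y)"
proof (rule is_pullbackI)
  show "Ident C X \<in> Hom C X X" "g \<in> Hom C Y X" "g \<in> Hom C Y X" "Ident C Y \<in> Hom C Y Y"
    using g Hom_Obj Ident_in_Hom by auto
  show "Comp C (Ident C X) g = Comp C g (Ident C Y)"
    using g by (simp add: Ident_Comp Comp_Ident)
  fix W p q assume "p \<in> Hom C W X" "q \<in> Hom C W Y" "Comp C (Ident C X) p = Comp C g q"
  then show "\<exists>!h. h \<in> Hom C W Y \<and> Comp C g h = p \<and> Comp C (Ident C Y) h = q"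
    by (metis Ident_Comp)
qed

text \<open>A cone over the outer rectangle is lifted in two stages: first into the square over
  \<open>u\<close>, using \<open>r\<close> followed by \<open>v\<close>, and then into the square
  over \<open>v\<close>.\<close>

lemma pullback_pasting:
  assumes pb: "is_pullback C u g p q" and pb': "is_pullback C v p p' q'"
    and u: "u \<in> Hom C Y X" and v: "v \<in> Hom C Z Y"
  shows "is_pullback C (Comp C u v) g p' (Comp C q q')"
proof (rule is_pullbackI)
  note g = is_pullbackD[OF pb u] and p' = is_pullbackD[OF pb' v]
  show "Comp C u v \<in> Hom C Z X" "g \<in> Hom C (Dom C g) X" "p' \<in> Hom C (Dom C p') Z"
    "Comp C q q' \<in> Hom C (Dom C p') (Dom C g)"
    using Comp_in_Hom u v g p' by auto
  show "Comp C (Comp C u v) p' = Comp C g (Comp C q q')"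
    using Comp_assoc[OF p'(2) v u] Comp_assoc[OF p'(3) g(2) u] Comp_assoc[OF p'(3) g(3,1)] p'(4) g(4)
    by simp
  fix W r s assume r: "r \<in> Hom C W Z" and s: "s \<in> Hom C W (Dom C g)"
    and eq: "Comp C (Comp C u v) r = Comp C g s"
  have vr: "Comp C v r \<in> Hom C W Y" "Comp C u (Comp C v r) = Comp C g s"
    using Comp_in_Hom[OF r v] Comp_assoc[OF r v u] eq by auto
  obtain h where h: "h \<in> Hom C W (Dom C p)" "Comp C p h = Comp C v r" "Comp C q h = s"
    using is_pullback_lift[OF pb u vr(1) s vr(2)] by blast
  obtain k where k: "k \<in> Hom C W (Dom C p')" "Comp C p' k = r" "Comp C q' k = h"
    using is_pullback_lift[OF pb' v r h(1) h(2)[symmetric]] by blast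
  show "\<exists>!k. k \<in> Hom C W (Dom C p') \<and> Comp C p' k = r \<and> Comp C (Comp C q q') k = s"
  proof (intro ex1I[of _ k] conjI)
    show "Comp C (Comp C q q') k = s"
      using Comp_assoc[OF k(1) p'(3) g(3)] k h by simp
    \<comment> \<open>Composing a competitor \<open>k'\<close> with \<open>q'\<close> gives another
      solution of the first lifting problem, hence \<open>h\<close>; then \<open>k'\<close> solves
      the second problem and equals \<open>k\<close>.\<close>
    fix k' assume k': "k' \<in> Hom C W (Dom C p') \<and> Comp C p' k' = r \<and> Comp C (Comp C q q') k' = s"
    then have "Comp C q' k' \<in> Hom C W (Dom C p)" "Comp C q (Comp C q' k') = s"
      "Comp C p (Comp C q' k') = Comp C v r"
      using Comp_in_Hom[of k' W "Dom C p'", OF _ p'(3)] Comp_assoc[of k' W "Dom C p'", OF _ p'(3) g(3)]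
        Comp_assoc[of k' W "Dom C p'", OF _ p'(3) g(2)] Comp_assoc[of k' W "Dom C p'", OF _ p'(2) v] p'(4)
      by auto
    then have "Comp C q' k' = h"
      using is_pullback_lift[OF pb u vr(1) s vr(2)] h by blast
    then show "k' = k"
      using is_pullback_lift[OF pb' v r h(1) h(2)[symmetric]] k k' by blast
  qed (use k in auto)
qed

end

locale doctrine_with_pullbacks = doctrine C P
  for C :: "('o, 'm) cat" and P :: "('o, 'm, 'p) doctrine_data" +
  assumes pullback_exists: "u \<in> Hom C Y X \<Longrightarrow> g \<in> Hom C Z X \<Longrightarrow> \<exists>p q. is_pullback C u g p q"
begin

lemma completion_pairs_iff:
  "(g, b) \<in> completion_pairs C P X \<longleftrightarrow> g \<in> Hom C (Dom C g) X \<and> b \<in> Fib P (Dom C g)"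
  by (auto simp: completion_pairs_def Hom_def)

text \<open>Pasting the two pullbacks gives a pullback along the composite, and functoriality of
  \<open>Reindex P\<close> identifies the predicates. No comparison of different pullbacks is
  involved.\<close>

lemma completion_act_Comp:
  assumes v: "v \<in> Hom C Z Y" and u: "u \<in> Hom C Y X" and x: "x \<in> completion_pairs C P X"
    and y: "y \<in> completion_act C P u x" and z: "z \<in> completion_act C P v y"
  shows "z \<in> completion_act C P (Comp C u v) x"
proof -
  obtain g b p q p' q' where d: "x = (g, b)" "y = (p, Reindex P q b)" "is_pullback C u g p q"
    "z = (p', Reindex P q' (Reindex P q b))" "is_pullback C v p p' q'"
    using y z by (cases x) (auto simp: completion_act_def)
  note g = is_pullbackD[OF d(3) u] and p = is_pullbackD[OF d(5) v]
  have "b \<in> Fib P (Dom C g)"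
    using x d by (simp add: completion_pairs_iff)
  then have "Reindex P (Comp C q q') b = Reindex P q' (Reindex P q b)"
    using Reindex_Comp p(3) g(3) by blast
  then show ?thesis
    using pullback_pasting[OF d(3,5) u v] d unfolding completion_act_def by force
qed

text \<open>Identities and composites of the witnessing arrows give a preorder. Monotonicity of
  reindexing comes from the universal property of the target pullback.\<close>

lemma preordered_action_ex:
  "preordered_action C (completion_pairs C P) (\<lambda>_. ex_le C P) (completion_act C P)"
proof
  fix X x assume X: "X \<in> Obj C" and "x \<in> completion_pairs C P X"
  then obtain g b where x: "x = (g, b)" "g \<in> Hom C (Dom C g) X" "b \<in> Fib P (Dom C g)"
    by (cases x) (simp add: completion_pairs_iff)
  have i: "Ident C (Dom C g) \<in> Hom C (Dom C g) (Dom C g)" "Reindex P (Ident C (Dom C g)) b = b"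
    using x Hom_Obj Ident_in_Hom Reindex_Ident by auto
  show "ex_le C P x x"
    using i(1) Comp_Ident[OF x(2)] Le_refl[OF Hom_Obj(1)[OF x(2)] x(3)] by (auto simp: ex_le_def x(1) i(2))
  have "x = (g, Reindex P (Ident C (Dom C g)) b)"
    using x i by simp
  then show "x \<in> completion_act C P (Ident C X) x"
    using pullback_Ident[OF x(2)] x(1) unfolding completion_act_def by blast
next
  fix X x y z assume "X \<in> Obj C" and
    xyz: "x \<in> completion_pairs C P X" "y \<in> completion_pairs C P X" "z \<in> completion_pairs C P X"
    and le: "ex_le C P x y" "ex_le C P y z"
  obtain f a g b k c where d: "x = (f, a)" "y = (g, b)" "z = (k, c)"
    by (cases x, cases y, cases z)
  have f: "f \<in> Hom C (Dom C f) X" "a \<in> Fib P (Dom C f)" "g \<in> Hom C (Dom C g) X" "b \<in> Fib P (Dom C g)"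
    "k \<in> Hom C (Dom C k) X" "c \<in> Fib P (Dom C k)"
    using xyz d by (simp_all add: completion_pairs_iff)
  obtain h where h: "h \<in> Hom C (Dom C f) (Dom C g)" "Comp C g h = f" "Le P (Dom C f) a (Reindex P h b)"
    using le(1) d unfolding ex_le_def by auto
  obtain h' where h': "h' \<in> Hom C (Dom C g) (Dom C k)" "Comp C k h' = g" "Le P (Dom C g) b (Reindex P h' c)"
    using le(2) d unfolding ex_le_def by auto
  have "Le P (Dom C f) (Reindex P h b) (Reindex P (Comp C h' h) c)"
    using Reindex_mono[OF h(1) f(4) _ h'(3)] Reindex_in_Fib[OF h'(1) f(6)] Reindex_Comp[OF h(1) h'(1) f(6)]
    by simp
  then have "Le P (Dom C f) a (Reindex P (Comp C h' h) c)"
    using Le_trans[OF _ f(2) _ _ h(3)] Hom_Obj f Reindex_in_Fib h h' Comp_in_Hom by metis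
  moreover have "Comp C k (Comp C h' h) = f"
    using Comp_assoc[OF h(1) h'(1) f(5)] h h' by simp
  ultimately show "ex_le C P x z"
    using d Comp_in_Hom[OF h(1) h'(1)] unfolding ex_le_def by auto
next
  fix u X Y x y assume u: "u \<in> Hom C Y X" and x: "x \<in> completion_pairs C P X"
    and y: "y \<in> completion_act C P u x"
  obtain g b p q where d: "x = (g, b)" "y = (p, Reindex P q b)" "is_pullback C u g p q"
    using y by (cases x) (auto simp: completion_act_def)
  show "y \<in> completion_pairs C P Y"
    using is_pullbackD[OF d(3) u] x d Reindex_in_Fib by (simp add: completion_pairs_iff)
next
  fix u X Y x assume "u \<in> Hom C Y X" "x \<in> completion_pairs C P X"
  then show "\<exists>y. y \<in> completion_act C P u x"
    using pullback_exists unfolding completion_act_def by (cases x) (auto simp: completion_pairs_iff)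
next
  fix u X Y x x' y y' assume u: "u \<in> Hom C Y X"
    and x: "x \<in> completion_pairs C P X" and x': "x' \<in> completion_pairs C P X"
    and le: "ex_le C P x x'" and y: "y \<in> completion_act C P u x" and y': "y' \<in> completion_act C P u x'"
  obtain g b p q where d: "x = (g, b)" "y = (p, Reindex P q b)" "is_pullback C u g p q"
    using y by (cases x) (auto simp: completion_act_def)
  obtain g' b' p' q' where d': "x' = (g', b')" "y' = (p', Reindex P q' b')" "is_pullback C u g' p' q'"
    using y' by (cases x') (auto simp: completion_act_def)
  note p = is_pullbackD[OF d(3) u] and p' = is_pullbackD[OF d'(3) u]
  have b: "b \<in> Fib P (Dom C g)" "b' \<in> Fib P (Dom C g')"
    using x x' d d' by (auto simp: completion_pairs_iff)
  obtain h where h: "h \<in> Hom C (Dom C g) (Dom C g')" "Comp C g' h = g" "Le P (Dom C g) b (Reindex P h b')"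
    using le d d' unfolding ex_le_def by auto
  \<comment> \<open>The arrow \<open>q\<close> followed by \<open>h\<close> forms with
    \<open>p\<close> a cone over \<open>u\<close> and \<open>g'\<close>; the induced
    \<open>k\<close> witnesses the inequality after reindexing.\<close>
  have "Comp C u p = Comp C g' (Comp C h q)"
    using p(4) h(2) Comp_assoc[OF p(3) h(1) p'(1)] by simp
  then obtain k where k: "k \<in> Hom C (Dom C p) (Dom C p')" "Comp C p' k = p" "Comp C q' k = Comp C h q"
    using is_pullback_lift[OF d'(3) u p(2) Comp_in_Hom[OF p(3) h(1)]] by blast
  have "Reindex P q (Reindex P h b') = Reindex P k (Reindex P q' b')"
    using Reindex_Comp[OF p(3) h(1) b(2)] Reindex_Comp[OF k(1) p'(3) b(2)] k(3) by simp
  then have "Le P (Dom C p) (Reindex P q b) (Reindex P k (Reindex P q' b'))"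
    using Reindex_mono[OF p(3) b(1) Reindex_in_Fib[OF h(1) b(2)] h(3)] by simp
  then show "ex_le C P y y'"
    using d d' k unfolding ex_le_def by auto
qed (rule completion_act_Comp)

text \<open>The universal completion is the existential completion of the fibrewise opposite
  doctrine, with the resulting order reversed again.\<close>

lemma preordered_action_univ:
  "preordered_action C (completion_pairs C P) (\<lambda>_. univ_le C P) (completion_act C P)"
proof -
  \<comment> \<open>Pairs and actions do not mention the order, so \<open>P'\<close> has the same
    ones as \<open>P\<close>; only the comparison of predicates changes direction.\<close>
  define P' where "P' = P\<lparr>Le := \<lambda>X a b. Le P X b a\<rparr>"
  have [simp]: "Fib P' = Fib P" "Reindex P' = Reindex P" "Le P' = (\<lambda>X a b. Le P X b a)"
    by (simp_all add: P'_def)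
  have "doctrine_with_pullbacks C P'"
    by unfold_locales
      (simp_all add: finite_products Le_refl Le_antisym Reindex_in_Fib Reindex_mono Reindex_Ident
        Reindex_Comp pullback_exists, use Le_trans in blast)
  then interpret P': doctrine_with_pullbacks C P' .
  have "completion_pairs C P' = completion_pairs C P" "completion_act C P' = completion_act C P"
    "(\<lambda>(X :: 'o) x y. ex_le C P' y x) = (\<lambda>_. univ_le C P)"
    by (auto simp: completion_pairs_def completion_act_def ex_le_def univ_le_def fun_eq_iff)
  then show ?thesis
    using preordered_action.dual[OF P'.preordered_action_ex] by simp
qed

end

section \<open>Extensional functions as the arrows of the category of sets\<close>

section \<open>The category of sets\<close>

lemma Set_cat_simps [simp]:
  "Obj (Set_cat U) = U"
  "Dom (Set_cat U) (X, Y, f) = X"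
  "Cod (Set_cat U) (X, Y, f) = Y"
  "Ident (Set_cat U) X = (X, X, \<lambda>x\<in>X. x)"
  "Comp (Set_cat U) (Y', Z, g) (X, Y, f) = (X, Z, compose X g f)"
  by (simp_all add: Set_cat_def)

lemma Hom_Set_cat_iff [simp]:
  "(X', Y', f) \<in> Hom (Set_cat U) X Y \<longleftrightarrow> X' = X \<and> Y' = Y \<and> X \<in> U \<and> Y \<in> U \<and> f \<in> X \<rightarrow>\<^sub>E Y"
  by (auto simp: Hom_def Set_cat_def)

lemma Hom_Set_catE:
  assumes "a \<in> Hom (Set_cat U) X Y"
  obtains f where "a = (X, Y, f)" "X \<in> U" "Y \<in> U" "f \<in> X \<rightarrow>\<^sub>E Y"
  using assms by (cases a) auto

lemma ex1_Hom_Set_cat: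
  assumes "\<exists>!h. h \<in> X \<rightarrow>\<^sub>E Y \<and> P h" "X \<in> U" "Y \<in> U" "\<And>h. Q (X, Y, h) \<longleftrightarrow> P h"
  shows "\<exists>!h. h \<in> Hom (Set_cat U) X Y \<and> Q h"
proof -
  obtain h where h: "h \<in> X \<rightarrow>\<^sub>E Y" "P h" and unique: "\<And>h'. h' \<in> X \<rightarrow>\<^sub>E Y \<Longrightarrow> P h' \<Longrightarrow> h' = h"
    using assms(1) by blast
  show ?thesis
    by (rule ex1I[of _ "(X, Y, h)"]) (use h assms(2-4) in \<open>auto elim!: Hom_Set_catE dest: unique\<close>)
qed

lemma compose_in_PiE: "f \<in> X \<rightarrow>\<^sub>E Y \<Longrightarrow> g \<in> Y \<rightarrow>\<^sub>E Z \<Longrightarrow> compose X g f \<in> X \<rightarrow>\<^sub>E Z"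
  by (auto simp: compose_def)

lemma compose_PiE_assoc:
  "f \<in> X \<rightarrow>\<^sub>E Y \<Longrightarrow> compose X (compose Y h g) f = compose X h (compose X g f)"
  by (auto simp: compose_def fun_eq_iff)

lemma compose_PiE_id: "f \<in> X \<rightarrow>\<^sub>E Y \<Longrightarrow> compose X f (\<lambda>x\<in>X. x) = f"
  by (auto simp: compose_def fun_eq_iff PiE_def extensional_def)

lemma id_compose_PiE: "f \<in> X \<rightarrow>\<^sub>E Y \<Longrightarrow> compose X (\<lambda>y\<in>Y. y) f = f"
  by (auto simp: compose_def fun_eq_iff PiE_def extensional_def)

lemma category_Set_cat: "category (Set_cat U)"
proof
  show "Dom (Set_cat U) f \<in> Obj (Set_cat U)" "Cod (Set_cat U) f \<in> Obj (Set_cat U)"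
    if "f \<in> Arr (Set_cat U)" for f
    using that by (auto simp: Set_cat_def)
qed (auto elim!: Hom_Set_catE
    simp: compose_in_PiE compose_PiE_assoc compose_PiE_id id_compose_PiE)

section \<open>Smallness, and pullbacks and products inside the universe\<close>

context set_universe_for
begin

lemma small_inj:
  assumes B: "small_in U B" and f: "inj_on f B'" "f ` B' \<subseteq> B"
  shows "small_in U B'"
proof -
  obtain X e where X: "X \<in> U" and e: "bij_betw e X B"
    using B unfolding small_in_def by blast
  let ?X = "inv_into X e ` f ` B'"
  have inv: "bij_betw (inv_into X e) B X"
    by (rule bij_betw_inv_into[OF e])
  have "?X \<in> U"
    using inv f(2) by (intro subset_closed[OF X]) (auto simp: bij_betw_def)
  moreover have "bij_betw (inv_into X e \<circ> f) B' ?X"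
    using comp_inj_on[OF f(1) inj_on_subset[OF bij_betw_imp_inj_on[OF inv] f(2)]]
    by (simp add: bij_betw_def image_comp)
  ultimately show ?thesis
    unfolding small_in_def using bij_betw_inv_into by blast
qed

lemma small_member: "X \<in> U \<Longrightarrow> small_in U X"
  unfolding small_in_def using bij_betw_id by blast

lemma small_Times:
  assumes "small_in U B" "small_in U B'"
  shows "small_in U (B \<times> B')"
proof -
  obtain X e X' e' where "X \<in> U" "bij_betw e X B" "X' \<in> U" "bij_betw e' X' B'"
    using assms unfolding small_in_def by blast
  moreover from this have "bij_betw (inv_into X e) B X" "bij_betw (inv_into X' e') B' X'"
    by (auto intro: bij_betw_inv_into)
  ultimately show ?thesis
    by (intro small_inj[OF Times_small[of X X'], of "map_prod (inv_into X e) (inv_into X' e')"])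
      (auto simp: bij_betw_def intro: map_prod_inj_on)
qed

lemma small_algebra: "small_in U \<AA>"
  by (rule small_inj[OF Pow_small, of "\<lambda>a. {a}"]) auto

text \<open>The pairs in \<open>P\<close> need not be elements of the type \<open>'u\<close>, so
  \<open>D\<close> indexes them by a bijection \<open>e\<close> and \<open>p\<close>,
  \<open>q\<close> are the coordinates of \<open>e\<close>. Products arise from the full relation
  and pullbacks from the pairs on which two functions agree.\<close>

lemma represent_relation:
  assumes Y: "Y \<in> U" and Z: "Z \<in> U" and P: "P \<subseteq> Y \<times> Z"
  obtains D p q where "D \<in> U" "p \<in> D \<rightarrow>\<^sub>E Y" "q \<in> D \<rightarrow>\<^sub>E Z" "(\<lambda>d. (p d, q d)) ` D = P"
    "\<And>(W :: 'u set) p' q'. p' \<in> W \<rightarrow>\<^sub>E Y \<Longrightarrow> q' \<in> W \<rightarrow>\<^sub>E Z \<Longrightarrow> (\<And>w. w \<in> W \<Longrightarrow> (p' w, q' w) \<in> P)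
      \<Longrightarrow> \<exists>!h. h \<in> W \<rightarrow>\<^sub>E D \<and> compose W p h = p' \<and> compose W q h = q'"
proof -
  have "small_in U P"
    using small_inj[OF Times_small[OF Y Z], of id P] P by simp
  then obtain D e where D: "D \<in> U" and e: "bij_betw e D P"
    unfolding small_in_def by blast
  define p where "p = restrict (fst \<circ> e) D"
  define q where "q = restrict (snd \<circ> e) D"
  have pq: "(p d, q d) = e d" if "d \<in> D" for d
    using that by (simp add: p_def q_def)
  have eP: "e d \<in> P" if "d \<in> D" for d
    using e that by (auto simp: bij_betw_def)
  show thesis
  proof (rule that[OF D])
    show p: "p \<in> D \<rightarrow>\<^sub>E Y" and q: "q \<in> D \<rightarrow>\<^sub>E Z"
      using eP P by (fastforce simp: p_def q_def)+
    show "(\<lambda>d. (p d, q d)) ` D = P"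
      using e pq by (auto simp: bij_betw_def)
    fix W p' q' assume p': "p' \<in> W \<rightarrow>\<^sub>E Y" and q': "q' \<in> W \<rightarrow>\<^sub>E Z"
      and in_P: "\<And>w. w \<in> W \<Longrightarrow> (p' w, q' w) \<in> P"
    \<comment> \<open>A lift must send \<open>w\<close> to the index of the pair
      \<open>(p' w, q' w)\<close>, which is unique since \<open>e\<close> is injective.\<close>
    define h where "h = (\<lambda>w\<in>W. inv_into D e (p' w, q' w))"
    have h: "h w \<in> D \<and> e (h w) = (p' w, q' w)" if "w \<in> W" for w
      using in_P[OF that] e that by (auto simp: h_def bij_betw_def inv_into_into f_inv_into_f)
    have h': "p (h w) = p' w \<and> q (h w) = q' w" if "w \<in> W" for w
      using h[OF that] pq[of "h w"] by simp
    show "\<exists>!h. h \<in> W \<rightarrow>\<^sub>E D \<and> compose W p h = p' \<and> compose W q h = q'"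
    proof (intro ex1I[of _ h] conjI)
      show "h \<in> W \<rightarrow>\<^sub>E D"
        using h by (auto simp: h_def)
      show "compose W p h = p'" "compose W q h = q'"
        using p' q' h' by (auto simp: compose_def fun_eq_iff PiE_def extensional_def)
      fix k assume k: "k \<in> W \<rightarrow>\<^sub>E D \<and> compose W p k = p' \<and> compose W q k = q'"
      show "k = h"
      proof
        fix w
        show "k w = h w"
        proof (cases "w \<in> W")
          case True
          then have "k w \<in> D" "p (k w) = p' w" "q (k w) = q' w"
            using k by (auto simp: compose_def)
          then have "e (k w) = e (h w)"
            using pq h[OF True] by metis
          then show ?thesis
            using inj_onD[OF bij_betw_imp_inj_on[OF e]] h[OF True] \<open>k w \<in> D\<close> by blast
        next
          case False
          then show ?thesis
            using k by (auto simp: h_def PiE_def extensional_def)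
        qed
      qed
    qed
  qed
qed

text \<open>Besides the universal property, the explicit set of pairs is exported: it is what allows
  fibres over the pullback to be computed later.\<close>

lemma Set_pullback:
  assumes X: "X \<in> U" and Y: "Y \<in> U" and Z: "Z \<in> U"
    and u: "u \<in> Y \<rightarrow>\<^sub>E X" and g: "g \<in> Z \<rightarrow>\<^sub>E X"
  obtains D p q where "D \<in> U" "p \<in> D \<rightarrow>\<^sub>E Y" "q \<in> D \<rightarrow>\<^sub>E Z"
    "(\<lambda>d. (p d, q d)) ` D = {(y, z). y \<in> Y \<and> z \<in> Z \<and> u y = g z}"
    "is_pullback (Set_cat U) (Y, X, u) (Z, X, g) (D, Y, p) (D, Z, q)"
proof -
  interpret category "Set_cat U" by (rule category_Set_cat)
  let ?P = "{(y, z). y \<in> Y \<and> z \<in> Z \<and> u y = g z}"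
  obtain D p q where D: "D \<in> U" "p \<in> D \<rightarrow>\<^sub>E Y" "q \<in> D \<rightarrow>\<^sub>E Z" and im: "(\<lambda>d. (p d, q d)) ` D = ?P"
    and lift: "\<And>(W :: 'u set) p' q'. p' \<in> W \<rightarrow>\<^sub>E Y \<Longrightarrow> q' \<in> W \<rightarrow>\<^sub>E Z \<Longrightarrow> (\<And>w. w \<in> W \<Longrightarrow> (p' w, q' w) \<in> ?P)
      \<Longrightarrow> \<exists>!h. h \<in> W \<rightarrow>\<^sub>E D \<and> compose W p h = p' \<and> compose W q h = q'"
    by (rule represent_relation[OF Y Z, of ?P]) auto
  have "u (p d) = g (q d)" if "d \<in> D" for d
    using im that by blast
  then have eq: "compose D u p = compose D g q"
    by (simp add: compose_def cong: restrict_cong)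
  have "is_pullback (Set_cat U) (Y, X, u) (Z, X, g) (D, Y, p) (D, Z, q)"
  proof (rule is_pullbackI)
    fix W p' q' assume p': "p' \<in> Hom (Set_cat U) W Y" and q': "q' \<in> Hom (Set_cat U) W Z"
      and eq: "Comp (Set_cat U) (Y, X, u) p' = Comp (Set_cat U) (Z, X, g) q'"
    obtain p0 q0 where d: "p' = (W, Y, p0)" "q' = (W, Z, q0)" "W \<in> U" "p0 \<in> W \<rightarrow>\<^sub>E Y" "q0 \<in> W \<rightarrow>\<^sub>E Z"
      using p' q' by (auto elim!: Hom_Set_catE)
    have "u (p0 w) = g (q0 w)" if "w \<in> W" for w
      using eq that d by (auto simp: compose_def fun_eq_iff split: if_splits)
    then have "\<exists>!h. h \<in> W \<rightarrow>\<^sub>E D \<and> compose W p h = p0 \<and> compose W q h = q0"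
      using lift[OF d(4,5)] d(4,5) by auto
    then show "\<exists>!h. h \<in> Hom (Set_cat U) W D \<and> Comp (Set_cat U) (D, Y, p) h = p'
        \<and> Comp (Set_cat U) (D, Z, q) h = q'"
      by (rule ex1_Hom_Set_cat) (simp_all add: d D)
  qed (use assms D eq in auto)
  then show thesis
    using that[OF D im] by blast
qed

lemma has_finite_products_Set_cat: "has_finite_products (Set_cat U)"
  unfolding has_finite_products_def
proof (intro conjI ballI)
  \<comment> \<open>A power set is never empty, so the set indexing it supplies a point for the
    terminal object.\<close>
  obtain X e where X: "X \<in> U" "bij_betw e X (Pow \<AA>)"
    using Pow_small unfolding small_in_def by blast
  then obtain t where "t \<in> X"
    by (auto simp: bij_betw_def)
  then have t: "{t} \<in> U"
    using X subset_closed by auto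
  have "terminal (Set_cat U) {t}"
    unfolding terminal_def
  proof (intro conjI ballI)
    fix Y assume "Y \<in> Obj (Set_cat U)"
    then show "\<exists>!f. f \<in> Hom (Set_cat U) Y {t}"
      using t by (intro ex1I[of _ "(Y, {t}, \<lambda>y\<in>Y. t)"])
        (auto elim!: Hom_Set_catE simp: fun_eq_iff PiE_def extensional_def Pi_def)
  qed (use t in simp)
  then show "\<exists>T. terminal (Set_cat U) T" ..
next
  fix Y Z assume "Y \<in> Obj (Set_cat U)" "Z \<in> Obj (Set_cat U)"
  then have Y: "Y \<in> U" and Z: "Z \<in> U" by auto
  obtain D p q where D: "D \<in> U" "p \<in> D \<rightarrow>\<^sub>E Y" "q \<in> D \<rightarrow>\<^sub>E Z"
    and lift: "\<And>(W :: 'u set) p' q'. p' \<in> W \<rightarrow>\<^sub>E Y \<Longrightarrow> q' \<in> W \<rightarrow>\<^sub>E Z \<Longrightarrow> (\<And>w. w \<in> W \<Longrightarrow> (p' w, q' w) \<in> Y \<times> Z)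
      \<Longrightarrow> \<exists>!h. h \<in> W \<rightarrow>\<^sub>E D \<and> compose W p h = p' \<and> compose W q h = q'"
    by (rule represent_relation[OF Y Z subset_refl]) auto
  have "is_product (Set_cat U) Y Z D (D, Y, p) (D, Z, q)"
    unfolding is_product_def
  proof (intro conjI ballI)
    fix W p' q' assume p': "p' \<in> Hom (Set_cat U) W Y" and q': "q' \<in> Hom (Set_cat U) W Z"
    obtain p0 q0 where d: "p' = (W, Y, p0)" "q' = (W, Z, q0)" "W \<in> U" "p0 \<in> W \<rightarrow>\<^sub>E Y" "q0 \<in> W \<rightarrow>\<^sub>E Z"
      using p' q' by (auto elim!: Hom_Set_catE)
    have "\<exists>!h. h \<in> W \<rightarrow>\<^sub>E D \<and> compose W p h = p0 \<and> compose W q h = q0"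
      using lift[OF d(4,5)] d(4,5) by auto
    then show "\<exists>!h. h \<in> Hom (Set_cat U) W D \<and> Comp (Set_cat U) (D, Y, p) h = p'
        \<and> Comp (Set_cat U) (D, Z, q) h = q'"
      by (rule ex1_Hom_Set_cat) (simp_all add: d D)
  qed (use Y Z D in auto)
  then show "\<exists>D p q. is_product (Set_cat U) Y Z D p q" by blast
qed

lemma Set_pullback_exists:
  assumes "u \<in> Hom (Set_cat U) Y X" "g \<in> Hom (Set_cat U) Z X"
  shows "\<exists>p q. is_pullback (Set_cat U) u g p q"
proof -
  obtain u' g' where "u = (Y, X, u')" "g = (Z, X, g')" and h: "X \<in> U" "Y \<in> U" "Z \<in> U"
    "u' \<in> Y \<rightarrow>\<^sub>E X" "g' \<in> Z \<rightarrow>\<^sub>E X"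
    using assms by (auto elim!: Hom_Set_catE)
  moreover obtain D p q where "is_pullback (Set_cat U) (Y, X, u') (Z, X, g') (D, Y, p) (D, Z, q)"
    by (rule Set_pullback[OF h])
  ultimately show ?thesis
    by blast
qed

end

section \<open>Identity and composition realizers in the sub-PCA\<close>

section \<open>Combinators\<close>

context elementary_sub_pca
begin

text \<open>The element is \<open>s k k\<close>: applied to \<open>a\<close> it yields
  \<open>(k a) (k a)\<close>, which is \<open>a\<close>. It lies in the sub-PCA because
  \<open>k\<close> and \<open>s\<close> do.\<close>

lemma sub_identity:
  obtains i where "i \<in> \<AA>'" "\<And>a. a \<in> \<AA> \<Longrightarrow> app i a = Some a"
proof -
  obtain k s where ks: "k \<in> \<AA>'" "s \<in> \<AA>'" "is_ks \<AA> app k s"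
    using sub_ex_ks by blast
  have k: "k \<in> \<AA>"
    using ks sub_subset by auto
  obtain sk where sk: "app s k = Some sk"
    using ks(3) k unfolding is_ks_def by blast
  obtain i where i: "app sk k = Some i"
    using ks(3) k sk unfolding is_ks_def papp_def by fastforce
  show thesis
  proof
    show "i \<in> \<AA>'"
      using sub_app_closed[OF sub_app_closed[OF ks(2,1) sk] ks(1) i] .
    fix a assume a: "a \<in> \<AA>"
    obtain ka where ka: "app k a = Some ka"
      using ks(3) a unfolding is_ks_def by blast
    have kaa: "app ka b = Some a" if "b \<in> \<AA>" for b
      using ks(3) a ka that unfolding is_ks_def papp_def dir_eq_def by fastforce
    have "dir_eq (papp app (papp app (app s k) (Some k)) (Some a)) (papp app (app k a) (app k a))"
      using ks(3) a k unfolding is_ks_def by blast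
    then show "app i a = Some a"
      using kaa[OF app_closed[OF k a ka]] by (simp add: sk i ka papp_def dir_eq_def)
  qed
qed

text \<open>The element is \<open>s (k a) b\<close>: applied to \<open>x\<close> it yields
  \<open>(k a x) (b x)\<close>, that is \<open>a (b x)\<close>. The directed equality for
  \<open>s\<close> becomes an actual one because the right-hand side is assumed to be
  defined.\<close>

lemma sub_compose:
  assumes a: "a \<in> \<AA>'" and b: "b \<in> \<AA>'"
  obtains c where "c \<in> \<AA>'"
    "\<And>x y z. x \<in> \<AA> \<Longrightarrow> app b x = Some y \<Longrightarrow> app a y = Some z \<Longrightarrow> app c x = Some z"
proof -
  obtain k s where ks: "k \<in> \<AA>'" "s \<in> \<AA>'" "is_ks \<AA> app k s"
    using sub_ex_ks by blast
  have A: "a \<in> \<AA>" "b \<in> \<AA>"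
    using a b sub_subset by auto
  obtain ka where ka: "app k a = Some ka"
    using ks(3) A unfolding is_ks_def by blast
  have ka': "ka \<in> \<AA>'" "ka \<in> \<AA>"
    using sub_app_closed[OF ks(1) a ka] sub_subset by auto
  obtain ska where ska: "app s ka = Some ska"
    using ks(3) ka' unfolding is_ks_def by blast
  obtain c where c: "app ska b = Some c"
    using ks(3) A ka' ska unfolding is_ks_def papp_def by fastforce
  show thesis
  proof
    show "c \<in> \<AA>'"
      using sub_app_closed[OF sub_app_closed[OF ks(2) ka'(1) ska] b c] .
    fix x y z assume x: "x \<in> \<AA>" and y: "app b x = Some y" and z: "app a y = Some z"
    have "dir_eq (papp app (app k a) (Some x)) (Some a)"
      using ks(3) A x unfolding is_ks_def by blast
    then have "app ka x = Some a"
      by (simp add: ka papp_def dir_eq_def)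
    moreover have "dir_eq (papp app (papp app (app s ka) (Some b)) (Some x)) (papp app (app ka x) (app b x))"
      using ks(3) A ka' x unfolding is_ks_def by blast
    ultimately show "app c x = Some z"
      by (simp add: ska c y z papp_def dir_eq_def)
  qed
qed

end

section \<open>The Turing doctrine and its universal completion as doctrines\<close>

section \<open>The Dialectica construction on the Turing doctrine\<close>

lemma turing_le_compose:
  assumes "u \<in> Y \<rightarrow>\<^sub>E X" "turing_le app \<AA>' X \<alpha> \<beta>"
  shows "turing_le app \<AA>' Y (compose Y \<alpha> u) (compose Y \<beta> u)"
proof -
  obtain a where "a \<in> \<AA>'" "\<And>x. x \<in> X \<Longrightarrow> app a (\<beta> x) = Some (\<alpha> x)"
    using assms(2) unfolding turing_le_def by blast
  then show ?thesis
    using PiE_mem[OF assms(1)] unfolding turing_le_def by (intro bexI[of _ a]) (simp_all add: compose_def)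
qed

locale pca_in_universe = elementary_sub_pca \<AA> app \<AA>' + set_universe_for U \<AA>
  for \<AA> :: "'a set" and app :: "'a \<Rightarrow> 'a \<Rightarrow> 'a option" and \<AA>' :: "'a set" and U :: "'u set set"
begin

abbreviation Turing :: "('u set, 'u fn, ('u \<Rightarrow> 'a) set) doctrine_data" where
  "Turing \<equiv> turing_doctrine U \<AA> app \<AA>'"

text \<open>Reflexivity is realized by the identity combinator and transitivity by composition of
  realizers; reindexing keeps the realizer.\<close>

sublocale T_act: preordered_action "Set_cat U" "\<lambda>X. X \<rightarrow>\<^sub>E \<AA>" "turing_le app \<AA>'"
  "\<lambda>(X', X, u) \<alpha>. {compose X' \<alpha> u}"
proof (intro preordered_action.intro category_Set_cat preordered_action_axioms.intro)
  fix X and \<alpha> :: "'u \<Rightarrow> 'a" assume \<alpha>: "\<alpha> \<in> X \<rightarrow>\<^sub>E \<AA>"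
  then have "\<alpha> x \<in> \<AA>" if "x \<in> X" for x
    using that by auto
  then show "turing_le app \<AA>' X \<alpha> \<alpha>"
    using sub_identity unfolding turing_le_def by metis
  show "\<alpha> \<in> (case Ident (Set_cat U) X of (X', X, u) \<Rightarrow> \<lambda>\<alpha>. {compose X' \<alpha> u}) \<alpha>"
    using \<alpha> by (simp add: compose_PiE_id)
next
  fix X and \<alpha> \<beta> \<gamma> :: "'u \<Rightarrow> 'a" assume \<gamma>: "\<gamma> \<in> X \<rightarrow>\<^sub>E \<AA>"
    and le: "turing_le app \<AA>' X \<alpha> \<beta>" "turing_le app \<AA>' X \<beta> \<gamma>"
  obtain a b where a: "a \<in> \<AA>'" "\<And>x. x \<in> X \<Longrightarrow> app a (\<beta> x) = Some (\<alpha> x)"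
    and b: "b \<in> \<AA>'" "\<And>x. x \<in> X \<Longrightarrow> app b (\<gamma> x) = Some (\<beta> x)"
    using le unfolding turing_le_def by blast
  obtain c where "c \<in> \<AA>'"
    "\<And>x y z. x \<in> \<AA> \<Longrightarrow> app b x = Some y \<Longrightarrow> app a y = Some z \<Longrightarrow> app c x = Some z"
    using sub_compose[OF a(1) b(1)] by blast
  then show "turing_le app \<AA>' X \<alpha> \<gamma>"
    using a(2) b(2) \<gamma> unfolding turing_le_def by (metis PiE_mem)
next
  fix u X Y and \<alpha> \<beta> :: "'u \<Rightarrow> 'a"
  assume "u \<in> Hom (Set_cat U) Y X" "\<alpha> \<in> X \<rightarrow>\<^sub>E \<AA>"
    "\<beta> \<in> (case u of (X', X, u) \<Rightarrow> \<lambda>\<alpha>. {compose X' \<alpha> u}) \<alpha>"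
  then show "\<beta> \<in> Y \<rightarrow>\<^sub>E \<AA>"
    by (elim Hom_Set_catE) (simp add: compose_in_PiE)
qed (auto elim!: Hom_Set_catE simp: compose_PiE_assoc intro: turing_le_compose)

sublocale T: doctrine_with_pullbacks "Set_cat U" Turing
  unfolding turing_doctrine_def
  by (intro doctrine_with_pullbacks.intro doctrine_with_pullbacks_axioms.intro
      T_act.doctrine_reflection has_finite_products_Set_cat Set_pullback_exists)

abbreviation Univ :: "('u set, 'u fn, ('u fn \<times> ('u \<Rightarrow> 'a) set) set) doctrine_data" where
  "Univ \<equiv> full_univ_completion (Set_cat U) Turing"

sublocale V_act: preordered_action "Set_cat U" "completion_pairs (Set_cat U) Turing"
  "\<lambda>_. univ_le (Set_cat U) Turing" "completion_act (Set_cat U) Turing"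
  by (rule T.preordered_action_univ)

text \<open>Having a doctrine with pullbacks again is what allows the existential completion to be
  applied on top of the universal one.\<close>

sublocale V: doctrine_with_pullbacks "Set_cat U" Univ
  unfolding full_univ_completion_def
  by (intro doctrine_with_pullbacks.intro doctrine_with_pullbacks_axioms.intro
      V_act.doctrine_reflection has_finite_products_Set_cat Set_pullback_exists)

section \<open>Elements of the universal completion as families of subsets of the algebra\<close>

abbreviation degree :: "'u set \<Rightarrow> ('u \<Rightarrow> 'a) \<Rightarrow> ('u \<Rightarrow> 'a) set" where
  "degree X \<equiv> T_act.cls X"

lemma Fib_Turing: "Fib Turing X = degree X ` (X \<rightarrow>\<^sub>E \<AA>)"
  unfolding turing_doctrine_def by (rule T_act.Fib_reflection)

lemma Le_Turing:
  assumes "X \<in> U" "\<alpha> \<in> X \<rightarrow>\<^sub>E \<AA>" "\<beta> \<in> X \<rightarrow>\<^sub>E \<AA>"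
  shows "Le Turing X (degree X \<alpha>) (degree X \<beta>) \<longleftrightarrow> turing_le app \<AA>' X \<alpha> \<beta>"
  using T_act.Le_reflection[of X \<alpha> \<beta>] assms unfolding turing_doctrine_def by simp

lemma Reindex_Turing:
  assumes "X \<in> U" "Y \<in> U" "u \<in> Y \<rightarrow>\<^sub>E X" "\<alpha> \<in> X \<rightarrow>\<^sub>E \<AA>"
  shows "Reindex Turing (Y, X, u) (degree X \<alpha>) = degree Y (compose Y \<alpha> u)"
  using T_act.Reindex_reflection[of "(Y, X, u)" Y X \<alpha> "compose Y \<alpha> u"] assms
  unfolding turing_doctrine_def by simp

definition fibre_values :: "'u set \<Rightarrow> ('u \<Rightarrow> 'u) \<Rightarrow> ('u \<Rightarrow> 'a) \<Rightarrow> 'u \<Rightarrow> 'a set" where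
  "fibre_values C g \<alpha> b = \<alpha> ` {c \<in> C. g c = b}"

lemma univ_pair_iff:
  "x \<in> completion_pairs (Set_cat U) Turing B \<longleftrightarrow>
     (\<exists>C g \<alpha>. x = ((C, B, g), degree C \<alpha>) \<and> B \<in> U \<and> C \<in> U \<and> g \<in> C \<rightarrow>\<^sub>E B \<and> \<alpha> \<in> C \<rightarrow>\<^sub>E \<AA>)"
  by (cases x) (auto simp: T.completion_pairs_iff Fib_Turing)

text \<open>
  The arrow \<open>C' \<rightarrow> C\<close> witnessing the left-hand side chooses, for every \<open>c'\<close>, a preimage under \<open>\<alpha>\<close> in
  the fibre over \<open>g' c'\<close> of the value computed by \<open>a\<close>.
\<close>
lemma univ_le_iff:
  assumes "B \<in> U" and g: "C \<in> U" "g \<in> C \<rightarrow>\<^sub>E B" "\<alpha> \<in> C \<rightarrow>\<^sub>E \<AA>"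
    and g': "C' \<in> U" "g' \<in> C' \<rightarrow>\<^sub>E B" "\<alpha>' \<in> C' \<rightarrow>\<^sub>E \<AA>"
  shows "univ_le (Set_cat U) Turing ((C, B, g), degree C \<alpha>) ((C', B, g'), degree C' \<alpha>') \<longleftrightarrow>
    (\<exists>a\<in>\<AA>'. \<forall>b\<in>B. \<forall>q\<in>fibre_values C' g' \<alpha>' b. \<exists>r\<in>fibre_values C g \<alpha> b. app a q = Some r)"
    (is "?L \<longleftrightarrow> ?R")
proof
  assume ?L
  then obtain h where h: "h \<in> Hom (Set_cat U) C' C" "Comp (Set_cat U) (C, B, g) h = (C', B, g')"
    "Le Turing C' (Reindex Turing h (degree C \<alpha>)) (degree C' \<alpha>')"
    unfolding univ_le_def by auto
  obtain k where k: "h = (C', C, k)" "k \<in> C' \<rightarrow>\<^sub>E C"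
    using h(1) by (auto elim: Hom_Set_catE)
  have "turing_le app \<AA>' C' (compose C' \<alpha> k) \<alpha>'"
    using h(3) k g g' by (simp add: Reindex_Turing Le_Turing compose_in_PiE)
  then obtain a where a: "a \<in> \<AA>'" "\<And>c. c \<in> C' \<Longrightarrow> app a (\<alpha>' c) = Some (\<alpha> (k c))"
    unfolding turing_le_def by (auto simp: compose_def)
  have "g (k c) = g' c" if "c \<in> C'" for c
    using h(2) k that by (auto simp: compose_def)
  then show ?R
    using a k(2) unfolding fibre_values_def by fastforce
next
  assume ?R
  then obtain a where a: "a \<in> \<AA>'"
    "\<And>b q. b \<in> B \<Longrightarrow> q \<in> fibre_values C' g' \<alpha>' b \<Longrightarrow> \<exists>r\<in>fibre_values C g \<alpha> b. app a q = Some r"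
    by blast
  have "\<exists>c. c \<in> C \<and> g c = g' c' \<and> app a (\<alpha>' c') = Some (\<alpha> c)" if "c' \<in> C'" for c'
  proof -
    have "g' c' \<in> B"
      using g' that by auto
    then show ?thesis
      using a(2)[of "g' c'" "\<alpha>' c'"] that unfolding fibre_values_def by auto
  qed
  then obtain k where k: "\<And>c'. c' \<in> C' \<Longrightarrow> k c' \<in> C \<and> g (k c') = g' c' \<and> app a (\<alpha>' c') = Some (\<alpha> (k c'))"
    by metis
  define h where "h = restrict k C'"
  have h: "h \<in> C' \<rightarrow>\<^sub>E C"
    using k by (auto simp: h_def)
  moreover have "compose C' g h = g'"
    using k g' by (auto simp: h_def compose_def fun_eq_iff PiE_def extensional_def)
  moreover have "turing_le app \<AA>' C' (compose C' \<alpha> h) \<alpha>'"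
    using k a(1) unfolding turing_le_def by (auto simp: h_def compose_def)
  ultimately show ?L
    using g g' unfolding univ_le_def
    by (auto simp: Reindex_Turing Le_Turing compose_in_PiE intro!: bexI[of _ "(C', C, h)"])
qed

text \<open>A relation is used since one class \<open>E\<close> has many presentations, whose
  families need only be mutually realizable rather than equal.\<close>

definition univ_rep :: "'u set \<Rightarrow> ('u fn \<times> ('u \<Rightarrow> 'a) set) set \<Rightarrow> ('u \<Rightarrow> 'a set) \<Rightarrow> bool" where
  "univ_rep B E Q \<longleftrightarrow> (\<exists>C g \<alpha>. C \<in> U \<and> g \<in> C \<rightarrow>\<^sub>E B \<and> \<alpha> \<in> C \<rightarrow>\<^sub>E \<AA> \<and>
     E = V_act.cls B ((C, B, g), degree C \<alpha>) \<and> (\<forall>b\<in>B. Q b = fibre_values C g \<alpha> b))"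

lemma univ_rep_values: "univ_rep B E Q \<Longrightarrow> Q \<in> B \<rightarrow> Pow \<AA>"
  unfolding univ_rep_def fibre_values_def by auto

lemma univ_rep_Fib: "B \<in> U \<Longrightarrow> univ_rep B E Q \<Longrightarrow> E \<in> Fib Univ B"
  unfolding full_univ_completion_def V_act.Fib_reflection univ_rep_def
  using univ_pair_iff by blast

lemma univ_rep_exists:
  assumes "E \<in> Fib Univ B"
  shows "\<exists>Q. univ_rep B E Q"
proof -
  obtain C g \<alpha> where "C \<in> U" "g \<in> C \<rightarrow>\<^sub>E B" "\<alpha> \<in> C \<rightarrow>\<^sub>E \<AA>" "E = V_act.cls B ((C, B, g), degree C \<alpha>)"
    using assms unfolding full_univ_completion_def V_act.Fib_reflection univ_pair_iff image_iff Bex_def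
    by blast
  then show ?thesis
    unfolding univ_rep_def by blast
qed

lemma univ_rep_Le:
  assumes B: "B \<in> U" and E: "univ_rep B E Q" and E': "univ_rep B E' Q'"
  shows "Le Univ B E E' \<longleftrightarrow> (\<exists>a\<in>\<AA>'. \<forall>b\<in>B. \<forall>q\<in>Q' b. \<exists>r\<in>Q b. app a q = Some r)"
proof -
  obtain C g \<alpha> where g: "C \<in> U" "g \<in> C \<rightarrow>\<^sub>E B" "\<alpha> \<in> C \<rightarrow>\<^sub>E \<AA>"
    and E: "E = V_act.cls B ((C, B, g), degree C \<alpha>)" and Q: "\<forall>b\<in>B. Q b = fibre_values C g \<alpha> b"
    using E unfolding univ_rep_def by blast
  obtain C' g' \<alpha>' where g': "C' \<in> U" "g' \<in> C' \<rightarrow>\<^sub>E B" "\<alpha>' \<in> C' \<rightarrow>\<^sub>E \<AA>"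
    and E': "E' = V_act.cls B ((C', B, g'), degree C' \<alpha>')" and Q': "\<forall>b\<in>B. Q' b = fibre_values C' g' \<alpha>' b"
    using E' unfolding univ_rep_def by blast
  have "Le Univ B E E' \<longleftrightarrow> univ_le (Set_cat U) Turing ((C, B, g), degree C \<alpha>) ((C', B, g'), degree C' \<alpha>')"
    unfolding full_univ_completion_def E E'
    using V_act.Le_reflection[of B "((C, B, g), degree C \<alpha>)" "((C', B, g'), degree C' \<alpha>')"] B g g'
    by (simp add: univ_pair_iff) blast
  then show ?thesis
    using univ_le_iff[OF B g g'] Q Q' by simp
qed

text \<open>Pulling \<open>g\<close> back along \<open>u\<close> leaves fibres unchanged: the fibre
  of \<open>p\<close> over \<open>b\<close> is carried by \<open>q\<close> onto the fibre of
  \<open>g\<close> over \<open>u b\<close>, so the values of \<alpha> on it are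
  \<open>Q (u b)\<close>.\<close>

lemma univ_rep_Reindex:
  assumes B: "B \<in> U" and B': "B' \<in> U" and u: "u \<in> B' \<rightarrow>\<^sub>E B" and E: "univ_rep B E Q"
  shows "univ_rep B' (Reindex Univ (B', B, u) E) (\<lambda>b. Q (u b))"
proof -
  obtain C g \<alpha> where g: "C \<in> U" "g \<in> C \<rightarrow>\<^sub>E B" "\<alpha> \<in> C \<rightarrow>\<^sub>E \<AA>"
    and E: "E = V_act.cls B ((C, B, g), degree C \<alpha>)" and Q: "\<forall>b\<in>B. Q b = fibre_values C g \<alpha> b"
    using E unfolding univ_rep_def by blast
  obtain D p q where D: "D \<in> U" "p \<in> D \<rightarrow>\<^sub>E B'" "q \<in> D \<rightarrow>\<^sub>E C"
    and im: "(\<lambda>d. (p d, q d)) ` D = {(y, z). y \<in> B' \<and> z \<in> C \<and> u y = g z}"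
    and pb: "is_pullback (Set_cat U) (B', B, u) (C, B, g) (D, B', p) (D, C, q)"
    by (rule Set_pullback[OF B B' g(1) u g(2)])
  have "((D, B', p), degree D (compose D \<alpha> q)) \<in> completion_act (Set_cat U) Turing (B', B, u) ((C, B, g), degree C \<alpha>)"
    using pb Reindex_Turing[OF g(1) D(1,3) g(3)] unfolding completion_act_def by force
  then have "Reindex Univ (B', B, u) E = V_act.cls B' ((D, B', p), degree D (compose D \<alpha> q))"
    unfolding E full_univ_completion_def
    using B B' u g by (intro V_act.Reindex_reflection[of _ _ B]) (auto simp: univ_pair_iff)
  moreover have "Q (u b) = fibre_values D p (compose D \<alpha> q) b" if b: "b \<in> B'" for b
  proof -
    have "{c \<in> C. g c = u b} = q ` {d \<in> D. p d = b}"
    proof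
      show "{c \<in> C. g c = u b} \<subseteq> q ` {d \<in> D. p d = b}"
      proof
        fix c assume "c \<in> {c \<in> C. g c = u b}"
        then have "(b, c) \<in> (\<lambda>d. (p d, q d)) ` D"
          using im b by simp
        then show "c \<in> q ` {d \<in> D. p d = b}" by auto
      qed
      show "q ` {d \<in> D. p d = b} \<subseteq> {c \<in> C. g c = u b}"
        using im by force
    qed
    then show ?thesis
      using Q PiE_mem[OF u b] by (auto simp: fibre_values_def image_image compose_def)
  qed
  ultimately show ?thesis
    using D compose_in_PiE[OF D(3) g(3)] unfolding univ_rep_def by blast
qed

text \<open>Take for the domain an indexing set of the disjoint union \<open>Sigma B Q\<close>, with
  the two projections as \<open>g\<close> and \<alpha>. It is small as a subset of
  \<open>B \<times> \<AA>\<close>.\<close>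

lemma univ_rep_surj:
  assumes B: "B \<in> U" and Q: "Q \<in> B \<rightarrow> Pow \<AA>"
  shows "\<exists>E. univ_rep B E Q"
proof -
  have "small_in U (Sigma B Q)"
    using Q by (intro small_inj[OF small_Times[OF small_member[OF B] small_algebra], of id]) auto
  then obtain C e where C: "C \<in> U" and e: "bij_betw e C (Sigma B Q)"
    unfolding small_in_def by blast
  have eC: "e ` C = Sigma B Q"
    using e by (simp add: bij_betw_def)
  then have e_in: "e c \<in> Sigma B Q" if "c \<in> C" for c
    using that by blast
  let ?g = "restrict (fst \<circ> e) C" and ?\<alpha> = "restrict (snd \<circ> e) C"
  have "Q b = fibre_values C ?g ?\<alpha> b" if b: "b \<in> B" for b
  proof
    show "Q b \<subseteq> fibre_values C ?g ?\<alpha> b"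
    proof
      fix q assume "q \<in> Q b"
      then obtain c where "c \<in> C" "e c = (b, q)"
        using eC b by (metis (no_types, lifting) SigmaI imageE)
      then show "q \<in> fibre_values C ?g ?\<alpha> b"
        unfolding fibre_values_def by force
    qed
    show "fibre_values C ?g ?\<alpha> b \<subseteq> Q b"
      using e_in unfolding fibre_values_def by fastforce
  qed
  moreover have "?g \<in> C \<rightarrow>\<^sub>E B" "?\<alpha> \<in> C \<rightarrow>\<^sub>E \<AA>"
    using e_in Q by fastforce+
  ultimately show ?thesis
    using C unfolding univ_rep_def by blast
qed

end

section \<open>The preorder defining \<DD>, image objects and the isomorphism\<close>

section \<open>Comparison with \<open>\<DD>\<close>\<close>

lemma D_act_eq:
  "D_act (Y, X, u) (R, F) =
     ({(y, A). y \<in> Y \<and> (u y, A) \<in> R}, \<lambda>(y, A)\<in>{(y, A). y \<in> Y \<and> (u y, A) \<in> R}. F (u y, A))"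
  by (simp add: D_act_def Let_def)

context pca_in_universe
begin

abbreviation leD :: "('u, 'a) dobj \<Rightarrow> ('u, 'a) dobj \<Rightarrow> bool" where
  "leD \<equiv> D_le \<AA> app \<AA>'"

text \<open>Choice trades the function \<phi> for pointwise existence of \<open>A'\<close>.
  Membership of the target in \<open>D_objs\<close> guarantees that the chosen sets are subsets of
  \<AA>.\<close>

lemma leD_iff:
  assumes "(S, G) \<in> D_objs \<AA> X"
  shows "leD (R, F) (S, G) \<longleftrightarrow>
    (\<exists>h\<in>\<AA>'. \<forall>(x, A)\<in>R. \<exists>A'. (x, A') \<in> S \<and> (\<forall>q\<in>G (x, A'). \<exists>r\<in>F (x, A). app h q = Some r))"
    (is "_ \<longleftrightarrow> ?R")
proof
  show "leD (R, F) (S, G) \<Longrightarrow> ?R"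
    unfolding D_le_def by fast
next
  assume ?R
  then obtain h where h: "h \<in> \<AA>'"
    and "\<forall>z\<in>R. \<exists>A'. (fst z, A') \<in> S \<and> (\<forall>q\<in>G (fst z, A'). \<exists>r\<in>F z. app h q = Some r)"
    by fastforce
  then obtain \<phi> where \<phi>: "\<And>z. z \<in> R \<Longrightarrow>
      (fst z, \<phi> z) \<in> S \<and> (\<forall>q\<in>G (fst z, \<phi> z). \<exists>r\<in>F z. app h q = Some r)"
    by metis
  moreover have "\<phi> \<in> R \<rightarrow> Pow \<AA>"
  proof
    fix z assume "z \<in> R"
    then have "(fst z, \<phi> z) \<in> X \<times> Pow \<AA>"
      using \<phi> assms unfolding D_objs_def by blast
    then show "\<phi> z \<in> Pow \<AA>" by simp
  qed
  ultimately show "leD (R, F) (S, G)"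
    unfolding D_le_def prod.case by (intro bexI[of _ \<phi>] bexI[OF _ h]) auto
qed

lemma D_objs_values: "(R, F) \<in> D_objs \<AA> X \<Longrightarrow> z \<in> R \<Longrightarrow> F z \<subseteq> \<AA>"
  by (auto simp: D_objs_def)

lemma D_act_closed:
  assumes "u \<in> Y \<rightarrow>\<^sub>E X" "x \<in> D_objs \<AA> X"
  shows "D_act (Y, X, u) x \<in> D_objs \<AA> Y"
proof -
  obtain R F where "x = (R, F)" "R \<subseteq> X \<times> Pow \<AA>" "F \<in> R \<rightarrow>\<^sub>E Pow \<AA>"
    using assms(2) unfolding D_objs_def by blast
  then show ?thesis
    using PiE_mem[of F R] by (auto simp: D_act_eq D_objs_def)
qed

lemma leD_trans:
  assumes "x \<in> D_objs \<AA> X" "y \<in> D_objs \<AA> X" "z \<in> D_objs \<AA> X" "leD x y" "leD y z"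
  shows "leD x z"
proof -
  obtain R F S G T K where d: "x = (R, F)" "y = (S, G)" "z = (T, K)"
    by (cases x, cases y, cases z)
  have S: "(S, G) \<in> D_objs \<AA> X" and T: "(T, K) \<in> D_objs \<AA> X"
    using assms d by auto
  obtain a where a: "a \<in> \<AA>'"
    "\<And>x A. (x, A) \<in> R \<Longrightarrow> \<exists>A'. (x, A') \<in> S \<and> (\<forall>q\<in>G (x, A'). \<exists>r\<in>F (x, A). app a q = Some r)"
    using assms(4) unfolding d leD_iff[OF S] by blast
  obtain b where b: "b \<in> \<AA>'"
    "\<And>x A. (x, A) \<in> S \<Longrightarrow> \<exists>A'. (x, A') \<in> T \<and> (\<forall>q\<in>K (x, A'). \<exists>r\<in>G (x, A). app b q = Some r)"
    using assms(5) unfolding d leD_iff[OF T] by blast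
  \<comment> \<open>Realizers run against the order: \<open>b\<close> takes values of
    \<open>K\<close> to values of \<open>G\<close>, then \<open>a\<close> takes these to values of
    \<open>F\<close>.\<close>
  obtain c where c: "c \<in> \<AA>'"
    "\<And>x y z. x \<in> \<AA> \<Longrightarrow> app b x = Some y \<Longrightarrow> app a y = Some z \<Longrightarrow> app c x = Some z"
    using sub_compose[OF a(1) b(1)] by blast
  have "\<exists>A'. (x, A') \<in> T \<and> (\<forall>q\<in>K (x, A'). \<exists>r\<in>F (x, A). app c q = Some r)" if "(x, A) \<in> R" for x A
  proof -
    obtain A1 where A1: "(x, A1) \<in> S" "\<forall>q\<in>G (x, A1). \<exists>r\<in>F (x, A). app a q = Some r"
      using a(2)[OF \<open>(x, A) \<in> R\<close>] by blast
    obtain A2 where A2: "(x, A2) \<in> T" "\<forall>q\<in>K (x, A2). \<exists>r\<in>G (x, A1). app b q = Some r"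
      using b(2)[OF A1(1)] by blast
    have "\<exists>r\<in>F (x, A). app c q = Some r" if "q \<in> K (x, A2)" for q
      using A1(2) A2(2) c(2) that D_objs_values[OF T A2(1)] by (meson subsetD)
    then show ?thesis
      using A2(1) by blast
  qed
  then show ?thesis
    unfolding d leD_iff[OF T] using c(1) by blast
qed

lemma D_act_mono:
  assumes u: "u \<in> Y \<rightarrow>\<^sub>E X" and y: "y \<in> D_objs \<AA> X" and le: "leD x y"
  shows "leD (D_act (Y, X, u) x) (D_act (Y, X, u) y)"
proof -
  obtain R F S G where d: "x = (R, F)" "y = (S, G)"
    by (cases x, cases y)
  have S: "(S, G) \<in> D_objs \<AA> X"
    using y d by auto
  obtain a where a: "a \<in> \<AA>'"
    "\<And>x A. (x, A) \<in> R \<Longrightarrow> \<exists>A'. (x, A') \<in> S \<and> (\<forall>q\<in>G (x, A'). \<exists>r\<in>F (x, A). app a q = Some r)"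
    using le unfolding d leD_iff[OF S] by blast
  show ?thesis
    unfolding d D_act_eq leD_iff[OF D_act_closed[OF u S, unfolded D_act_eq]]
    by (rule bexI[OF _ a(1)]) (use a(2) in fastforce)
qed

sublocale DD_act: preordered_action "Set_cat U" "D_objs \<AA>" "\<lambda>_. leD" "\<lambda>u x. {D_act u x}"
proof (intro preordered_action.intro category_Set_cat preordered_action_axioms.intro)
  fix X and x :: "('u, 'a) dobj" assume x: "x \<in> D_objs \<AA> X"
  obtain R F where d: "x = (R, F)" and RF: "(R, F) \<in> D_objs \<AA> X"
    using x by (cases x) auto
  obtain i where i: "i \<in> \<AA>'" "\<And>a. a \<in> \<AA> \<Longrightarrow> app i a = Some a"
    using sub_identity by blast
  show "leD x x"
    unfolding d leD_iff[OF RF]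
  proof (intro bexI[OF _ i(1)] ballI, clarify)
    fix x A assume xA: "(x, A) \<in> R"
    show "\<exists>A'. (x, A') \<in> R \<and> (\<forall>q\<in>F (x, A'). \<exists>r\<in>F (x, A). app i q = Some r)"
      using xA i(2) D_objs_values[OF RF xA] by blast
  qed
  have R: "{(y, A). y \<in> X \<and> ((\<lambda>x\<in>X. x) y, A) \<in> R} = R"
    using RF by (auto simp: D_objs_def)
  \<comment> \<open>Since \<open>F\<close> is extensional on \<open>R\<close>, reindexing along the
    identity returns the very same pair.\<close>
  have F: "(\<lambda>(y, A)\<in>R. F ((\<lambda>x\<in>X. x) y, A)) = F"
    using RF by (auto simp: D_objs_def fun_eq_iff PiE_def extensional_def restrict_def)
  show "x \<in> {D_act (Ident (Set_cat U) X) x}"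
    by (simp only: Set_cat_simps d D_act_eq R F singleton_iff)
next
  fix u v X Y Z and x y z :: "('u, 'a) dobj"
  assume v: "v \<in> Hom (Set_cat U) Z Y" and u: "u \<in> Hom (Set_cat U) Y X"
    and yz: "y \<in> {D_act u x}" "z \<in> {D_act v y}"
  obtain u' v' where uv: "u = (Y, X, u')" "v = (Z, Y, v')" "v' \<in> Z \<rightarrow>\<^sub>E Y"
    using u v by (auto elim!: Hom_Set_catE)
  obtain R F where d: "x = (R, F)" by (cases x)
  show "z \<in> {D_act (Comp (Set_cat U) u v) x}"
    using yz uv by (auto simp: d D_act_eq compose_def restrict_def fun_eq_iff)
qed (auto elim!: Hom_Set_catE intro: leD_trans D_act_closed D_act_mono)

text \<open>Indices with equal \<open>f b\<close> and \<open>Q b\<close> are merged. Nothing is lost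
  up to equivalence, because comparisons ask only whether a suitable index exists.\<close>

definition image_obj :: "'u set \<Rightarrow> ('u \<Rightarrow> 'u) \<Rightarrow> ('u \<Rightarrow> 'a set) \<Rightarrow> ('u, 'a) dobj" where
  "image_obj B f Q = (let R = (\<lambda>b. (f b, Q b)) ` B in (R, \<lambda>(x, A)\<in>R. A))"

lemma image_obj_in_D_objs:
  assumes "f \<in> B \<rightarrow>\<^sub>E X" "Q \<in> B \<rightarrow> Pow \<AA>"
  shows "image_obj B f Q \<in> D_objs \<AA> X"
  using assms by (fastforce simp: image_obj_def D_objs_def Let_def)

lemma leD_image_obj_iff:
  assumes "f' \<in> B' \<rightarrow>\<^sub>E X" "Q' \<in> B' \<rightarrow> Pow \<AA>"
  shows "leD (image_obj B f Q) (image_obj B' f' Q') \<longleftrightarrow>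
    (\<exists>a\<in>\<AA>'. \<forall>b\<in>B. \<exists>b'\<in>B'. f' b' = f b \<and> (\<forall>q\<in>Q' b'. \<exists>r\<in>Q b. app a q = Some r))"
proof -
  let ?R = "(\<lambda>b. (f b, Q b)) ` B" and ?S = "(\<lambda>b. (f' b, Q' b)) ` B'"
  have "(?S, \<lambda>(x, A)\<in>?S. A) \<in> D_objs \<AA> X"
    using image_obj_in_D_objs[OF assms] by (simp add: image_obj_def Let_def)
  note iff = leD_iff[OF this]
  have R: "(\<lambda>(x, A)\<in>?R. A) (f b, Q b) = Q b" if "b \<in> B" for b
    using that by simp
  \<comment> \<open>At a pair \<open>(x, A')\<close> in \<open>?S\<close> the function returns
    \<open>A'\<close>, which is \<open>Q' b'\<close> for some \<open>b'\<close> over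
    \<open>x\<close>; quantifying over sets therefore amounts to quantifying over indices.\<close>
  have S: "(\<exists>A'. (x, A') \<in> ?S \<and> (\<forall>q\<in>(\<lambda>(x, A)\<in>?S. A) (x, A'). P q)) \<longleftrightarrow>
      (\<exists>b'\<in>B'. f' b' = x \<and> (\<forall>q\<in>Q' b'. P q))" for x P
  proof -
    have "(x, A') \<in> ?S \<and> (\<forall>q\<in>(\<lambda>(x, A)\<in>?S. A) (x, A'). P q) \<longleftrightarrow>
        (\<exists>b'\<in>B'. x = f' b' \<and> A' = Q' b') \<and> (\<forall>q\<in>A'. P q)" for A'
      by (simp add: image_iff cong: conj_cong)
    then show ?thesis
      by (simp only:) auto
  qed
  show ?thesis
    unfolding image_obj_def Let_def iff S by (simp add: R cong: ball_cong)
qed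

text \<open>Index \<open>R\<close> itself by \<open>B\<close>, project to \<open>X\<close>, and let
  \<open>Q\<close> be \<open>F\<close> read along the indexing. Passing to the image replaces each
  \<open>A\<close> by \<open>F (x, A)\<close>, and the identity combinator realizes both
  inequalities.\<close>

lemma image_obj_surj:
  assumes X: "X \<in> U" and x: "x \<in> D_objs \<AA> X"
  obtains B f Q where "B \<in> U" "f \<in> B \<rightarrow>\<^sub>E X" "Q \<in> B \<rightarrow> Pow \<AA>"
    "leD x (image_obj B f Q)" "leD (image_obj B f Q) x"
proof -
  obtain R F where d: "x = (R, F)" and RF: "(R, F) \<in> D_objs \<AA> X"
    using x by (cases x) auto
  have "small_in U R"
    using RF by (intro small_inj[OF small_Times[OF small_member[OF X] Pow_small], of id])
      (auto simp: D_objs_def)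
  then obtain B e where B: "B \<in> U" and e: "bij_betw e B R"
    unfolding small_in_def by blast
  have eB: "e ` B = R"
    using e by (simp add: bij_betw_def)
  define f where "f = restrict (fst \<circ> e) B"
  define Q where "Q = F \<circ> e"
  have f: "f \<in> B \<rightarrow>\<^sub>E X"
    using RF eB by (fastforce simp: f_def D_objs_def)
  have Q: "Q \<in> B \<rightarrow> Pow \<AA>"
    unfolding Q_def comp_def using eB by (intro Pi_I PowI D_objs_values[OF RF]) blast
  have "(\<lambda>b. (f b, Q b)) ` B = (\<lambda>b. (fst (e b), F (e b))) ` B"
    by (rule image_cong) (simp_all add: f_def Q_def)
  then have im: "(\<lambda>b. (f b, Q b)) ` B = (\<lambda>z. (fst z, F z)) ` R"
    by (simp add: eB[symmetric] image_image)
  obtain i where i: "i \<in> \<AA>'" "\<And>a. a \<in> \<AA> \<Longrightarrow> app i a = Some a"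
    using sub_identity by blast
  have iF: "\<forall>q\<in>F z. \<exists>r\<in>F z. app i q = Some r" if "z \<in> R" for z
    using i(2) D_objs_values[OF RF that] by blast
  have obj: "((\<lambda>z. (fst z, F z)) ` R, \<lambda>(x, A)\<in>(\<lambda>z. (fst z, F z)) ` R. A) \<in> D_objs \<AA> X"
    using image_obj_in_D_objs[OF f Q] by (simp add: image_obj_def Let_def im)
  have "leD x (image_obj B f Q)"
    unfolding d image_obj_def Let_def im leD_iff[OF obj]
  proof (intro bexI[OF _ i(1)] ballI, clarify)
    fix x A assume xA: "(x, A) \<in> R"
    then have "(x, F (x, A)) \<in> (\<lambda>z. (fst z, F z)) ` R"
      by force
    then show "\<exists>A'. (x, A') \<in> (\<lambda>z. (fst z, F z)) ` R \<and>
        (\<forall>q\<in>(\<lambda>(x, A)\<in>(\<lambda>z. (fst z, F z)) ` R. A) (x, A'). \<exists>r\<in>F (x, A). app i q = Some r)"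
      using iF[OF xA] by (intro exI[of _ "F (x, A)"]) simp
  qed
  moreover have "leD (image_obj B f Q) x"
    unfolding d image_obj_def Let_def im leD_iff[OF RF]
  proof (intro bexI[OF _ i(1)] ballI, clarify)
    fix x A assume xA: "(x, A) \<in> R"
    then have "(x, F (x, A)) \<in> (\<lambda>z. (fst z, F z)) ` R"
      by force
    \<comment> \<open>The set in the image may come from several elements of \<open>R\<close>; the
      \<open>A\<close> it was obtained from serves as the witness.\<close>
    then show "\<exists>A'. (fst (x, A), A') \<in> R \<and> (\<forall>q\<in>F (fst (x, A), A').
        \<exists>r\<in>(\<lambda>(x, A)\<in>(\<lambda>z. (fst z, F z)) ` R. A) (fst (x, A), F (x, A)). app i q = Some r)"
      using iF[OF xA] xA by auto
  qed
  ultimately show thesis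
    using that[OF B f Q] by blast
qed

text \<open>The indices \<open>d\<close> run over the pairs \<open>(y, b)\<close> with
  \<open>u y = f b\<close>, so both sides have the relation of all \<open>(y, Q b)\<close>. This is
  an equality, not merely an equivalence.\<close>

lemma D_act_image_obj:
  assumes "(\<lambda>d. (p d, q d)) ` D = {(y, b). y \<in> Y \<and> b \<in> B \<and> u y = f b}"
  shows "D_act (Y, X, u) (image_obj B f Q) = image_obj D p (\<lambda>d. Q (q d))"
proof -
  have "{(y, A). y \<in> Y \<and> (u y, A) \<in> (\<lambda>b. (f b, Q b)) ` B} =
      (\<lambda>(y, b). (y, Q b)) ` {(y, b). y \<in> Y \<and> b \<in> B \<and> u y = f b}"
    by force
  then have R: "{(y, A). y \<in> Y \<and> (u y, A) \<in> (\<lambda>b. (f b, Q b)) ` B} = (\<lambda>d. (p d, Q (q d))) ` D"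
    unfolding assms[symmetric] by (simp add: image_image)
  \<comment> \<open>The inner function is restricted, so its argument must be shown to lie in its
    domain before it can be evaluated to \<open>A\<close>.\<close>
  have "(u y, A) \<in> (\<lambda>b. (f b, Q b)) ` B" if "(y, A) \<in> (\<lambda>d. (p d, Q (q d))) ` D" for y A
    using that unfolding R[symmetric] by blast
  then have "(\<lambda>(y, A)\<in>(\<lambda>d. (p d, Q (q d))) ` D. (\<lambda>(x, A)\<in>(\<lambda>b. (f b, Q b)) ` B. A) (u y, A)) =
      (\<lambda>(y, A)\<in>(\<lambda>d. (p d, Q (q d))) ` D. A)"
    by (intro restrict_ext) (clarify, simp)
  then show ?thesis
    by (simp add: image_obj_def Let_def D_act_eq R)
qed

text \<open>Both sides ask for one realizer valid for all \<open>b\<close>. The left asks in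
  addition for an arrow \<open>h\<close> over \<open>X\<close>, the right for some \<open>b'\<close>
  over each \<open>f b\<close>; these agree by choice.\<close>

lemma ex_le_iff:
  assumes f: "B \<in> U" "f \<in> B \<rightarrow>\<^sub>E X" "univ_rep B E Q" and f': "B' \<in> U" "f' \<in> B' \<rightarrow>\<^sub>E X" "univ_rep B' E' Q'"
  shows "ex_le (Set_cat U) Univ ((B, X, f), E) ((B', X, f'), E') \<longleftrightarrow>
    leD (image_obj B f Q) (image_obj B' f' Q')"
    (is "?L \<longleftrightarrow> ?R")
proof -
  have Le: "Le Univ B E (Reindex Univ (B, B', h) E') \<longleftrightarrow>
      (\<exists>a\<in>\<AA>'. \<forall>b\<in>B. \<forall>q\<in>Q' (h b). \<exists>r\<in>Q b. app a q = Some r)" if "h \<in> B \<rightarrow>\<^sub>E B'" for h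
    using univ_rep_Le[OF f(1,3) univ_rep_Reindex[OF f'(1) f(1) that f'(3)]] .
  note R = leD_image_obj_iff[OF f'(2) univ_rep_values[OF f'(3)], where B = B and f = f and Q = Q]
  show ?thesis
  proof
    assume ?L
    then obtain h where h: "h \<in> B \<rightarrow>\<^sub>E B'" "compose B f' h = f" "Le Univ B E (Reindex Univ (B, B', h) E')"
      unfolding ex_le_def by (auto elim!: Hom_Set_catE)
    have "h b \<in> B' \<and> f' (h b) = f b" if "b \<in> B" for b
      using h(1,2) that by (auto simp: compose_def)
    then show ?R
      using h(3) unfolding R Le[OF h(1)] by blast
  next
    assume ?R
    then obtain a h0 where a: "a \<in> \<AA>'" and h0: "\<And>b. b \<in> B \<Longrightarrow>
        h0 b \<in> B' \<and> f' (h0 b) = f b \<and> (\<forall>q\<in>Q' (h0 b). \<exists>r\<in>Q b. app a q = Some r)"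
      unfolding R by metis
    define h where "h = restrict h0 B"
    have h: "h \<in> B \<rightarrow>\<^sub>E B'"
      using h0 by (auto simp: h_def)
    moreover have "compose B f' h = f"
      using h0 f(2) by (auto simp: h_def compose_def fun_eq_iff PiE_def extensional_def)
    moreover have "Le Univ B E (Reindex Univ (B, B', h) E')"
      unfolding Le[OF h] using a h0 by (auto simp: h_def)
    ultimately show ?L
      using f f' unfolding ex_le_def by (auto intro!: bexI[of _ "(B, B', h)"])
  qed
qed

text \<open>Equivalence with the image object is demanded instead of equality, because in a general
  element of \<DD> the value \<open>F (x, A)\<close> differs from \<open>A\<close>.\<close>

definition dialectica_rep :: "'u set \<Rightarrow> ('u, 'a) dobj \<Rightarrow> 'u fn \<times> ('u fn \<times> ('u \<Rightarrow> 'a) set) set \<Rightarrow> bool" where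
  "dialectica_rep X x z \<longleftrightarrow> (\<exists>B f E Q. z = ((B, X, f), E) \<and> B \<in> U \<and> f \<in> B \<rightarrow>\<^sub>E X \<and> univ_rep B E Q \<and>
     leD x (image_obj B f Q) \<and> leD (image_obj B f Q) x)"

theorem D_isomorphic_dialectica:
  "doctrines_isomorphic (Set_cat U) (D_doctrine U \<AA> app \<AA>') (full_dialectica (Set_cat U) Turing)"
  unfolding D_doctrine_def full_dialectica_def full_ex_completion_def[of _ Univ]
proof (rule doctrines_isomorphic_reflectionI[where rel = dialectica_rep,
    OF DD_act.preordered_action_axioms V.preordered_action_ex has_finite_products_Set_cat])
  fix X and x :: "('u, 'a) dobj" assume "X \<in> Obj (Set_cat U)" and x: "x \<in> D_objs \<AA> X"
  then have X: "X \<in> U" by simp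
  obtain B f Q where B: "B \<in> U" "f \<in> B \<rightarrow>\<^sub>E X" and Q: "Q \<in> B \<rightarrow> Pow \<AA>"
    and le: "leD x (image_obj B f Q)" "leD (image_obj B f Q) x"
    using image_obj_surj[OF X x] by metis
  obtain E where E: "univ_rep B E Q"
    using univ_rep_surj[OF B(1) Q] by blast
  have "((B, X, f), E) \<in> completion_pairs (Set_cat U) Univ X"
    using X B univ_rep_Fib[OF B(1) E] by (simp add: V.completion_pairs_iff)
  then show "\<exists>z\<in>completion_pairs (Set_cat U) Univ X. dialectica_rep X x z"
    using B E le unfolding dialectica_rep_def by blast
next
  fix X z assume "z \<in> completion_pairs (Set_cat U) Univ X"
  then obtain B f E where B: "z = ((B, X, f), E)" "B \<in> U" "f \<in> B \<rightarrow>\<^sub>E X" "E \<in> Fib Univ B"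
    by (cases z) (auto simp: V.completion_pairs_iff elim!: Hom_Set_catE)
  obtain Q where Q: "univ_rep B E Q"
    using univ_rep_exists[OF B(4)] by blast
  have "image_obj B f Q \<in> D_objs \<AA> X"
    using image_obj_in_D_objs[OF B(3) univ_rep_values[OF Q]] .
  \<comment> \<open>The image object of a Dialectica element represents it, by reflexivity.\<close>
  moreover from this have "leD (image_obj B f Q) (image_obj B f Q)"
    using DD_act.le_refl[of X] B \<open>z \<in> completion_pairs (Set_cat U) Univ X\<close>
    by (simp add: V.completion_pairs_iff)
  ultimately show "\<exists>x\<in>D_objs \<AA> X. dialectica_rep X x z"
    using B Q unfolding dialectica_rep_def by blast
next
  fix X z z' and x x' :: "('u, 'a) dobj"
  assume x: "x \<in> D_objs \<AA> X" "x' \<in> D_objs \<AA> X" and rep: "dialectica_rep X x z" "dialectica_rep X x' z'"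
  obtain B f E Q where B: "z = ((B, X, f), E)" "B \<in> U" "f \<in> B \<rightarrow>\<^sub>E X" "univ_rep B E Q"
    and le: "leD x (image_obj B f Q)" "leD (image_obj B f Q) x"
    using rep(1) unfolding dialectica_rep_def by blast
  obtain B' f' E' Q' where B': "z' = ((B', X, f'), E')" "B' \<in> U" "f' \<in> B' \<rightarrow>\<^sub>E X" "univ_rep B' E' Q'"
    and le': "leD x' (image_obj B' f' Q')" "leD (image_obj B' f' Q') x'"
    using rep(2) unfolding dialectica_rep_def by blast
  have "image_obj B f Q \<in> D_objs \<AA> X" "image_obj B' f' Q' \<in> D_objs \<AA> X"
    using image_obj_in_D_objs B B' univ_rep_values by metis+
  then have "leD x x' \<longleftrightarrow> leD (image_obj B f Q) (image_obj B' f' Q')"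
    using leD_trans le le' x by meson
  then show "leD x x' \<longleftrightarrow> ex_le (Set_cat U) Univ z z'"
    using ex_le_iff[OF B(2-4) B'(2-4)] B B' by simp
next
  fix u X Y z and x :: "('u, 'a) dobj"
  assume "u \<in> Hom (Set_cat U) Y X" and x: "x \<in> D_objs \<AA> X" and rep: "dialectica_rep X x z"
  then obtain v where u: "u = (Y, X, v)" "Y \<in> U" "X \<in> U" "v \<in> Y \<rightarrow>\<^sub>E X"
    by (auto elim!: Hom_Set_catE)
  obtain B f E Q where B: "z = ((B, X, f), E)" "B \<in> U" "f \<in> B \<rightarrow>\<^sub>E X" "univ_rep B E Q"
    and le: "leD x (image_obj B f Q)" "leD (image_obj B f Q) x"
    using rep unfolding dialectica_rep_def by blast
  obtain D p q where D: "D \<in> U" "p \<in> D \<rightarrow>\<^sub>E Y" "q \<in> D \<rightarrow>\<^sub>E B"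
    and im: "(\<lambda>d. (p d, q d)) ` D = {(y, b). y \<in> Y \<and> b \<in> B \<and> v y = f b}"
    and pb: "is_pullback (Set_cat U) (Y, X, v) (B, X, f) (D, Y, p) (D, B, q)"
    by (rule Set_pullback[OF u(3,2) B(2) u(4) B(3)])
  have obj: "image_obj B f Q \<in> D_objs \<AA> X"
    using image_obj_in_D_objs[OF B(3) univ_rep_values[OF B(4)]] .
  \<comment> \<open>Monotonicity transports the equivalence of \<open>x\<close> with its image
    object along \<open>u\<close>, and the reindexed image object is the one built from the
    pullback.\<close>
  have "leD (D_act u x) (image_obj D p (\<lambda>d. Q (q d)))" "leD (image_obj D p (\<lambda>d. Q (q d))) (D_act u x)"
    using D_act_mono[OF u(4) obj le(1)] D_act_mono[OF u(4) x le(2)]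
    by (simp_all add: D_act_image_obj[where X = X and Q = Q, OF im] u(1))
  then have "dialectica_rep Y (D_act u x) ((D, Y, p), Reindex Univ (D, B, q) E)"
    using D univ_rep_Reindex[OF B(2) D(1,3) B(4)] unfolding dialectica_rep_def by blast
  moreover have "((D, Y, p), Reindex Univ (D, B, q) E) \<in> completion_act (Set_cat U) Univ u z"
    using pb unfolding completion_act_def u(1) B(1) by blast
  ultimately show "\<exists>x'\<in>{D_act u x}. \<exists>z'\<in>completion_act (Set_cat U) Univ u z. dialectica_rep Y x' z'"
    by blast
qed

end

theorem corollary6p35:
  fixes \<AA> \<AA>' :: "'a set" and app :: "'a \<Rightarrow> 'a \<Rightarrow> 'a option" and U :: "'u set set"
  assumes "pca \<AA> app"
    and "elementary_sub_pca \<AA> app \<AA>'"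
    and "set_universe_for U \<AA>"
  shows "doctrines_isomorphic (Set_cat U)
           (D_doctrine U \<AA> app \<AA>')
           (full_dialectica (Set_cat U) (turing_doctrine U \<AA> app \<AA>'))"
proof -
  interpret elementary_sub_pca \<AA> app \<AA>' by fact
  interpret set_universe_for U \<AA> by fact
  interpret pca_in_universe \<AA> app \<AA>' U ..
  show ?thesis by (rule D_isomorphic_dialectica)
qed

end
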